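(* Fix a finite alphabet $\Sigma$ and a DTD $D$ over $\Sigma$. There is a deterministic one-pass streaming algorithm (with no auxiliary streams) which, given as input stream $\mathrm{XML}(\mathrm{FCNS}^{\bot}(t))$ for a tree $t$ with $N$ nodes, decides whether $t$ is valid against $D$, using $\mathrm{O}(\sqrt{N\log N})$ space and $\mathrm{O}(1)$ processing time per letter.
   Context: Trees: finite rooted ordered (unranked) trees whose nodes are labeled by letters of $\Sigma$. For each label $a$ there is an opening tag $a$ and a closing tag $\bar a$; $\mathrm{XML}(s)$ of a tree $s$ is the sequence of tags of a depth-first left-to-right traversal (opening tag on entering a node, closing tag on leaving it). A DTD is a map $D$ from $\Sigma$ to regular expressions over $\Sigma$; a node labeled $a$ whose children (in order) are labeled $a_1,\dots,a_k$ is valid if $a_1\cdots a_k$ matches $D(a)$ (a leaf is valid iff the empty word matches $D(a)$); $t$ is valid against $D$ if all its nodes are valid. The DTD is fixed and not counted in the space. The First-Child-Next-Sibling tree $\mathrm{FCNS}(t)$ has the same nodes and root as $t$; the left child of $v$ is its first child in $t$ (if any) and the right child of $v$ is its next sibling in $t$ (if any). $\mathrm{FCNS}^{\bot}(t)$ is the (unannotated) tree obtained from $\mathrm{FCNS}(t)$ by adding, for every node having exactly one of the two children, a new leaf labeled by a fresh symbol $\bot\notin\Sigma$ in the place of the missing child (as left child if the left child is missing, as right child if the right child is missing); nodes with no children stay leaves. Streaming model: the input is read sequentially; space is the size of internal memory (in letters and bits); processing time per letter is the maximal running time between two consecutive read operations; arithmetic on integers of size $\mathrm{O}(N)$ takes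 constant time. *)

theory Defs
  imports Complex_Main "HOL-Library.Landau_Symbols" "HOL-Library.Tree"
begin

datatype 'a utree = Branch (label: 'a) (children: "'a utree list")

fun num_nodes :: "'a utree \<Rightarrow> nat" where
  "num_nodes (Branch a ts) = Suc (\<Sum>t\<leftarrow>ts. num_nodes t)"

datatype 'a tag = Opening 'a | Closing 'a

fun XML :: "'a utree \<Rightarrow> 'a tag list" where
  "XML (Branch a ts) = Opening a # concat (map XML ts) @ [Closing a]"

datatype 'a rexp =
  Empty | Epsilon | Atom 'a | Alt "'a rexp" "'a rexp" | Seq "'a rexp" "'a rexp" | Star "'a rexp"

fun lang :: "'a rexp \<Rightarrow> 'a list set" where
  "lang Empty = {}"
| "lang Epsilon = {[]}"
| "lang (Atom a) = {[a]}"
| "lang (Alt r s) = lang r \<union> lang s"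
| "lang (Seq r s) = {u @ v | u v. u \<in> lang r \<and> v \<in> lang s}"
| "lang (Star r) = {concat us | us. set us \<subseteq> lang r}"

type_synonym 'a dtd = "'a \<Rightarrow> 'a rexp"

fun valid :: "'a dtd \<Rightarrow> 'a utree \<Rightarrow> bool" where
  "valid D (Branch a ts) \<longleftrightarrow> map label ts \<in> lang (D a) \<and> (\<forall>t\<in>set ts. valid D t)"

text \<open>
  Binary trees are those of \<^theory>\<open>HOL-Library.Tree\<close>: \<^const>\<open>Leaf\<close> stands for an absent child, not
  for a node. The function below encodes a node together with its following siblings.
\<close>

fun FCNS_siblings :: "'a utree list \<Rightarrow> 'a tree" where
  "FCNS_siblings [] = Leaf"
| "FCNS_siblings (Branch a cs # ts) = Node (FCNS_siblings cs) a (FCNS_siblings ts)"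

definition FCNS :: "'a utree \<Rightarrow> 'a tree" where
  "FCNS t = FCNS_siblings [t]"

text \<open>
  The fresh label \<open>\<bottom>\<close> is \<^const>\<open>None\<close>. A node without children stays a leaf; otherwise each absent
  child becomes a leaf labelled \<open>\<bottom>\<close>.
\<close>

fun add_bot :: "'a tree \<Rightarrow> 'a option utree" where
  "add_bot Leaf = Branch None []"
| "add_bot (Node l a r) =
     Branch (Some a) (if l = Leaf \<and> r = Leaf then [] else [add_bot l, add_bot r])"

definition FCNS_bot :: "'a utree \<Rightarrow> 'a option utree" where
  "FCNS_bot t = add_bot (FCNS t)"

text \<open>
  A streaming algorithm is a program of a random access machine: finite control, and a memory of
  cells holding natural numbers, initially all zero. Reading a letter branches on it, or on
  \<^const>\<open>None\<close> at the end of the stream; for a finite alphabet this branching table is a finite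
  object. The stream is the only input; in particular its length is not given in advance.
\<close>

datatype arith = Add | Sub | Mul | Div

datatype 'l instr =
  Const nat nat
| Arith arith nat nat nat
| Load nat nat
| Store nat nat
| Jump nat
| JumpLess nat nat nat
| Read "'l option \<Rightarrow> nat"
| Halt bool

type_synonym 'l program = "'l instr list"

fun arith_op :: "arith \<Rightarrow> nat \<Rightarrow> nat \<Rightarrow> nat" where
  "arith_op Add x y = x + y"
| "arith_op Sub x y = x - y"
| "arith_op Mul x y = x * y"
| "arith_op Div x y = x div y"

record 'l config =
  pc :: nat
  mem :: "nat \<Rightarrow> nat"
  unread :: "'l list"

fun exec :: "'l instr \<Rightarrow> 'l config \<Rightarrow> 'l config" where
  "exec (Const i k) c = c\<lparr>pc := Suc (pc c), mem := (mem c)(i := k)\<rparr>"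
| "exec (Arith f i j k) c =
     c\<lparr>pc := Suc (pc c), mem := (mem c)(i := arith_op f (mem c j) (mem c k))\<rparr>"
| "exec (Load i j) c = c\<lparr>pc := Suc (pc c), mem := (mem c)(i := mem c (mem c j))\<rparr>"
| "exec (Store i j) c = c\<lparr>pc := Suc (pc c), mem := (mem c)(mem c i := mem c j)\<rparr>"
| "exec (Jump p) c = c\<lparr>pc := p\<rparr>"
| "exec (JumpLess i j p) c = c\<lparr>pc := (if mem c i < mem c j then p else Suc (pc c))\<rparr>"
| "exec (Read f) c =
     (case unread c of
        [] \<Rightarrow> c\<lparr>pc := f None\<rparr>
      | x # xs \<Rightarrow> c\<lparr>pc := f (Some x), unread := xs\<rparr>)"
| "exec (Halt b) c = c"

text \<open>A program counter outside the program is a crash: the machine is stuck without an answer.\<close>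

definition step :: "'l program \<Rightarrow> 'l config \<Rightarrow> 'l config" where
  "step P c = (if pc c < length P then exec (P ! pc c) c else c)"

definition config_at :: "'l program \<Rightarrow> 'l list \<Rightarrow> nat \<Rightarrow> 'l config" where
  "config_at P w n = (step P ^^ n) \<lparr>pc = 0, mem = (\<lambda>_. 0), unread = w\<rparr>"

definition reading :: "'l program \<Rightarrow> 'l config \<Rightarrow> bool" where
  "reading P c \<longleftrightarrow> pc c < length P \<and> (\<exists>f. P ! pc c = Read f)"

definition halted :: "'l program \<Rightarrow> 'l config \<Rightarrow> bool \<Rightarrow> bool" where
  "halted P c b \<longleftrightarrow> pc c < length P \<and> P ! pc c = Halt b"

definition answers :: "'l program \<Rightarrow> 'l list \<Rightarrow> bool \<Rightarrow> bool" where
  "answers P w b \<longleftrightarrow> (\<exists>n. halted P (config_at P w n) b)"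

text \<open>
  Consecutive reads are at most \<open>T\<close> steps apart. The same bound covers the steps before the first
  read and those from the last read to halting.
\<close>

definition time_per_letter_le :: "'l program \<Rightarrow> 'l list \<Rightarrow> nat \<Rightarrow> bool" where
  "time_per_letter_le P w T \<longleftrightarrow>
     (\<forall>n. \<exists>k<T. reading P (config_at P w (n + k)) \<or> (\<exists>b. halted P (config_at P w (n + k)) b))"

text \<open>
  Space in bits: \<open>ws\<close> is a fixed layout of the memory that is sufficient for the entire run, cell
  \<open>i\<close> being given \<open>ws ! i\<close> bits. Widths must be positive, so that skipped addresses are paid for
  and no information can be hidden in sparse addressing.
\<close>

definition space_le :: "'l program \<Rightarrow> 'l list \<Rightarrow> nat \<Rightarrow> bool" where
  "space_le P w S \<longleftrightarrow>
     (\<exists>ws. (\<forall>k\<in>set ws. 0 < k) \<and> sum_list ws \<le> S \<and>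
       (\<forall>n i. if i < length ws then mem (config_at P w n) i < 2 ^ (ws ! i)
              else mem (config_at P w n) i = 0))"

text \<open>
  Counting each instruction as one step is justified only for small operands, so the size of all
  integers occurring in a run is bounded separately.
\<close>

definition integers_le :: "'l program \<Rightarrow> 'l list \<Rightarrow> nat \<Rightarrow> bool" where
  "integers_le P w B \<longleftrightarrow> (\<forall>n i. mem (config_at P w n) i \<le> B)"

end

(*
In FCNS(t) the children of a node are the right spine of its first subtree. If the labels of siblings
are read from right to left, a finite automaton of right quotients computes its state on a child list
when the first sibling is closed. The state q of the first subtree of v must then be compared with
the label of v, which was read long before. The labels of the nodes whose first subtree is being read
form a stack B. When B exceeds its capacity it is cleared. A node whose label has been lost in this way
stores the pair (depth, q) on a stack E instead and is checked at its closing tag, which repeats the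
label. Nodes with simultaneous entries on E have disjoint first subtrees, each containing a clearing,
so after R clearings E has at most R entries. With capacity R log R for B after R clearings, N nodes
allow only R = O(sqrt(N / log N)) of them, and E and B both take O(sqrt(N log N)) bits.
*)

theory Submission
  imports Defs "HOL-Library.FuncSet" "HOL-Library.Sublist" "HOL-Library.Log_Nat"
begin

text \<open>Lost labels need no marks. A label pushed after a clearing inside a first subtree is
  gone again before that subtree ends, so at its end \<open>B\<close> is empty exactly if the label
  of the parent was lost. Depths do the same for \<open>E\<close>: an entry of the node being closed
  has the current depth, those of its ancestors are smaller. The count rests on the potential
  \<open>pushes R + length B\<close>: an opening tag raises it by at most one, a clearing leaves it
  unchanged. A label costs O(1) bits and an entry of \<open>E\<close> costs O(log N), so R entries
  balance R log N labels. As N is unknown, log R stands in for log N; if R is too small for the two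
  to be comparable, R log N is small anyway. The machine model shapes the rest. Skipped cells are
  charged, so two stacks of unknown final size are interleaved; constant time per letter forces
  clearing by resetting a pointer and updating the logarithm incrementally. Size bounds occur only
  in invariants carried along a run, never in the code.\<close>

section \<open>Structured code\<close>

datatype basic = Set nat nat | Calc arith nat nat nat | Fetch nat nat | Put nat nat

fun effect :: "basic \<Rightarrow> (nat \<Rightarrow> nat) \<Rightarrow> nat \<Rightarrow> nat" where
  "effect (Set i k) m = m(i := k)"
| "effect (Calc f i j k) m = m(i := arith_op f (m j) (m k))"
| "effect (Fetch i j) m = m(i := m (m j))"
| "effect (Put i j) m = m(m i := m j)"

fun instr_of :: "basic \<Rightarrow> 'l instr" where
  "instr_of (Set i k) = Const i k"
| "instr_of (Calc f i j k) = Arith f i j k"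
| "instr_of (Fetch i j) = Load i j"
| "instr_of (Put i j) = Store i j"

lemma exec_instr_of: "exec (instr_of i) c = c\<lparr>pc := Suc (pc c), mem := effect i (mem c)\<rparr>"
  by (cases i) simp_all

text \<open>\<open>Next s\<close> reads the next letter in the control state \<open>s\<close>.\<close>

datatype 's code =
  Do basic "'s code"
| If_less nat nat "'s code" "'s code"
| Next 's
| Stop bool

text \<open>
  \<open>runs I h b w c m\<close>: started in memory \<open>m\<close> with \<open>w\<close> unread, the code \<open>c\<close> halts with answer \<open>b\<close>, and
  all memories on the way satisfy \<open>I\<close>.
\<close>

inductive runs :: "((nat \<Rightarrow> nat) \<Rightarrow> bool) \<Rightarrow> ('s \<Rightarrow> 'l option \<Rightarrow> 's code) \<Rightarrow> bool \<Rightarrow>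
    'l list \<Rightarrow> 's code \<Rightarrow> (nat \<Rightarrow> nat) \<Rightarrow> bool"
  for I h b
where
  Do: "I m \<Longrightarrow> runs I h b w c (effect i m) \<Longrightarrow> runs I h b w (Do i c) m"
| If_less: "I m \<Longrightarrow> runs I h b w (if m i < m j then c else c') m \<Longrightarrow>
    runs I h b w (If_less i j c c') m"
| Read: "I m \<Longrightarrow> runs I h b w (h s (Some x)) m \<Longrightarrow> runs I h b (x # w) (Next s) m"
| End: "I m \<Longrightarrow> runs I h b [] (h s None) m \<Longrightarrow> runs I h b [] (Next s) m"
| Stop: "I m \<Longrightarrow> runs I h b w (Stop b) m"

lemma runs_imp_inv: "runs I h b w c m \<Longrightarrow> I m"
  by (erule runs.cases) auto

inductive_cases runs_DoE: "runs I h b w (Do i c) m"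
inductive_cases runs_If_lessE: "runs I h b w (If_less i j c c') m"
inductive_cases runs_StopE: "runs I h b w (Stop b') m"

lemma runs_Do [simp]: "runs I h b w (Do i c) m \<longleftrightarrow> I m \<and> runs I h b w c (effect i m)"
  by (blast intro: runs.Do elim: runs_DoE)

lemma runs_If_less [simp]:
  "runs I h b w (If_less i j c c') m \<longleftrightarrow>
     I m \<and> (if m i < m j then runs I h b w c m else runs I h b w c' m)"
  unfolding if_distrib[of "\<lambda>c. runs I h b w c m", symmetric]
  by (blast intro: runs.If_less elim: runs_If_lessE)

lemma runs_Stop [simp]: "runs I h b w (Stop b') m \<longleftrightarrow> I m \<and> b' = b"
  by (blast intro: runs.Stop elim: runs_StopE)

fun subcodes :: "'s code \<Rightarrow> 's code set" where
  "subcodes (Do i c) = insert (Do i c) (subcodes c)"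
| "subcodes (If_less i j c c') = insert (If_less i j c c') (subcodes c \<union> subcodes c')"
| "subcodes (Next s) = {Next s}"
| "subcodes (Stop b) = {Stop b}"

lemma finite_subcodes [simp]: "finite (subcodes c)"
  by (induction c) simp_all

lemma subcodes_refl [simp]: "c \<in> subcodes c"
  by (cases c) simp_all

lemma subcodes_trans: "c'' \<in> subcodes c' \<Longrightarrow> c' \<in> subcodes c \<Longrightarrow> c'' \<in> subcodes c"
  by (induction c) auto

fun code_height :: "'s code \<Rightarrow> nat" where
  "code_height (Do i c) = Suc (code_height c)"
| "code_height (If_less i j c c') = Suc (max (code_height c) (code_height c'))"
| "code_height (Next s) = 0"
| "code_height (Stop b) = 0"

section \<open>Compilation of structured code to machine programs\<close>

locale code_list =
  fixes h :: "'s \<Rightarrow> 'l option \<Rightarrow> 's code" and cs :: "'s code list"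
  assumes closed_subcodes: "c \<in> set cs \<Longrightarrow> subcodes c \<subseteq> set cs"
    and closed_Next: "Next s \<in> set cs \<Longrightarrow> h s l \<in> set cs"
begin

text \<open>
  Each code in the list is compiled to two instructions; the second one continues where the first
  one falls through.
\<close>

definition addr :: "'s code \<Rightarrow> nat" where
  "addr c = 2 * (SOME i. i < length cs \<and> cs ! i = c)"

fun slot :: "'s code \<Rightarrow> bool \<Rightarrow> 'l instr" where
  "slot (Do i c) second = (if second then Jump (addr c) else instr_of i)"
| "slot (If_less i j c c') second = (if second then Jump (addr c') else JumpLess i j (addr c))"
| "slot (Next s) second = (if second then Halt False else Read (\<lambda>l. addr (h s l)))"
| "slot (Stop b) second = Halt b"

definition prog :: "'l program" where
  "prog = map (\<lambda>p. slot (cs ! (p div 2)) (odd p)) [0..<2 * length cs]"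

text \<open>A relation rather than \<open>p = addr c\<close>: the initial code will occur twice in
  the list, and execution starts at address 0, which may differ from its
  \<open>addr\<close>.\<close>

definition located :: "'s code \<Rightarrow> nat \<Rightarrow> bool" where
  "located c p \<longleftrightarrow> (\<exists>i<length cs. p = 2 * i \<and> cs ! i = c)"

lemma located_addr: "c \<in> set cs \<Longrightarrow> located c (addr c)"
  unfolding located_def addr_def in_set_conv_nth by (rule someI2_ex) auto

lemma located_mem: "located c p \<Longrightarrow> c \<in> set cs"
  by (auto simp: located_def)

lemma prog_fetch:
  assumes "located c p"
  shows "p < length prog" "Suc p < length prog" "prog ! p = slot c False" "prog ! Suc p = slot c True"
  using assms by (auto simp: located_def prog_def)

lemma located_sub: "located c p \<Longrightarrow> c' \<in> subcodes c \<Longrightarrow> located c' (addr c')"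
  by (blast intro: located_addr dest: located_mem closed_subcodes)

lemma located_Do: "located (Do i c) p \<Longrightarrow> located c (addr c)"
  by (erule located_sub) simp

lemma located_If_less:
  assumes "located (If_less i j c c') p"
  shows "located c (addr c)" "located c' (addr c')"
  by (rule located_sub[OF assms], simp)+

lemma located_Next: "located (Next s) p \<Longrightarrow> located (h s l) (addr (h s l))"
  by (intro located_addr closed_Next) (rule located_mem)

lemmas located_closed = located_Do located_If_less located_Next

text \<open>The invariant is demanded at every machine step, since space and integer size are
  measured at all times.\<close>

definition good :: "((nat \<Rightarrow> nat) \<Rightarrow> bool) \<Rightarrow> bool \<Rightarrow> 'l config \<Rightarrow> bool" where
  "good I b c \<longleftrightarrow> (\<exists>n. halted prog ((step prog ^^ n) c) b \<and> (\<forall>k\<le>n. I (mem ((step prog ^^ k) c))))"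

lemma good_halted: "I (mem c) \<Longrightarrow> halted prog c b \<Longrightarrow> good I b c"
  unfolding good_def by (rule exI[of _ 0]) simp

lemma good_step:
  assumes "I (mem c)" "good I b (step prog c)"
  shows "good I b c"
proof -
  obtain n where n: "halted prog ((step prog ^^ n) (step prog c)) b"
      "\<And>k. k \<le> n \<Longrightarrow> I (mem ((step prog ^^ k) (step prog c)))"
    using assms(2) by (auto simp: good_def)
  have "I (mem ((step prog ^^ k) c))" if "k \<le> Suc n" for k
    using that assms(1) n(2)[of "k - 1"] by (cases k) (auto simp: funpow_Suc_right simp del: funpow.simps)
  then show ?thesis
    using n(1) unfolding good_def by (intro exI[of _ "Suc n"]) (auto simp: funpow_Suc_right simp del: funpow.simps)
qed

lemma runs_good:
  assumes "runs I h b w c m" "located c p"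
  shows "good I b \<lparr>pc = p, mem = m, unread = w\<rparr>"
  using assms
proof (induction arbitrary: p)
  case (Do m w c i)
  note f = prog_fetch[OF Do.prems]
  have "good I b (step prog (step prog \<lparr>pc = p, mem = m, unread = w\<rparr>))"
    using Do.IH[OF located_Do[OF Do.prems]] f by (simp add: step_def exec_instr_of)
  moreover have "I (mem (step prog \<lparr>pc = p, mem = m, unread = w\<rparr>))"
    using f runs_imp_inv[OF Do.hyps(2)] by (simp add: step_def exec_instr_of)
  ultimately show ?case
    using Do.hyps(1) by (metis good_step select_convs(2))
next
  case (If_less m w i j c c')
  note f = prog_fetch[OF If_less.prems]
  show ?case
  proof (cases "m i < m j")
    case True
    have "good I b \<lparr>pc = addr c, mem = m, unread = w\<rparr>"
      using If_less.IH True located_If_less(1)[OF If_less.prems] by simp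
    moreover have "step prog \<lparr>pc = p, mem = m, unread = w\<rparr> = \<lparr>pc = addr c, mem = m, unread = w\<rparr>"
      using f True by (simp add: step_def)
    ultimately show ?thesis
      using If_less.hyps(1) good_step by (metis select_convs(2))
  next
    case False
    have "good I b \<lparr>pc = addr c', mem = m, unread = w\<rparr>"
      using If_less.IH False located_If_less(2)[OF If_less.prems] by simp
    moreover have s1: "step prog \<lparr>pc = p, mem = m, unread = w\<rparr> = \<lparr>pc = Suc p, mem = m, unread = w\<rparr>"
      using f False by (simp add: step_def)
    moreover have "step prog \<lparr>pc = Suc p, mem = m, unread = w\<rparr> = \<lparr>pc = addr c', mem = m, unread = w\<rparr>"
      using f by (simp add: step_def)
    ultimately show ?thesis
      using If_less.hyps(1) good_step by (metis select_convs(2))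
  qed
next
  case (Read m w s x)
  then show ?case
    using prog_fetch[OF Read.prems] located_closed(4)[OF Read.prems]
    by - (rule good_step, simp_all add: step_def)
next
  case (End m s)
  then show ?case
    using prog_fetch[OF End.prems] located_closed(4)[OF End.prems]
    by - (rule good_step, simp_all add: step_def)
next
  case (Stop m w)
  then show ?case
    using prog_fetch[OF Stop.prems] by (intro good_halted) (simp_all add: halted_def)
qed

definition paused :: "'l config \<Rightarrow> bool" where
  "paused c \<longleftrightarrow> reading prog c \<or> (\<exists>b. halted prog c b)"

lemma paused_stepI:
  assumes "\<exists>k\<le>n. paused ((step prog ^^ k) (step prog c))"
  shows "\<exists>k\<le>Suc n. paused ((step prog ^^ k) c)"
proof -
  obtain k where "k \<le> n" "paused ((step prog ^^ k) (step prog c))"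
    using assms by blast
  then show ?thesis
    by (intro exI[of _ "Suc k"]) (simp add: funpow_Suc_right del: funpow.simps)
qed

lemma paused_located:
  assumes "located c (pc a)"
  shows "\<exists>k\<le>2 * code_height c. paused ((step prog ^^ k) a)"
  using assms
proof (induction c arbitrary: a)
  case (Do i c)
  note f = prog_fetch[OF Do.prems]
  have "\<exists>k\<le>Suc (Suc (2 * code_height c)). paused ((step prog ^^ k) a)"
    using f located_closed(1)[OF Do.prems]
    by (intro paused_stepI Do.IH) (simp add: step_def exec_instr_of)
  then show ?case by simp
next
  case (If_less i j c c')
  note f = prog_fetch[OF If_less.prems]
  show ?case
  proof (cases "mem a i < mem a j")
    case True
    have "\<exists>k\<le>Suc (2 * code_height c). paused ((step prog ^^ k) a)"
      using f True located_closed(2)[OF If_less.prems]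
      by (intro paused_stepI If_less.IH(1)) (simp add: step_def)
    then obtain k where "k \<le> Suc (2 * code_height c)" "paused ((step prog ^^ k) a)"
      by blast
    then show ?thesis
      by (intro exI[of _ k]) auto
  next
    case False
    have "\<exists>k\<le>Suc (Suc (2 * code_height c')). paused ((step prog ^^ k) a)"
      using f False located_closed(3)[OF If_less.prems]
      by (intro paused_stepI If_less.IH(2)) (simp add: step_def)
    then obtain k where "k \<le> Suc (Suc (2 * code_height c'))" "paused ((step prog ^^ k) a)"
      by blast
    then show ?thesis
      by (intro exI[of _ k]) auto
  qed
next
  case (Next s)
  then show ?case
    using prog_fetch[OF Next.prems] by (simp add: paused_def reading_def)
next
  case (Stop b)
  then show ?case
    using prog_fetch[OF Stop.prems] by (simp add: paused_def halted_def)
qed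

lemma pc_cases:
  assumes "p < length prog"
  obtains c where "located c p" | c p' where "located c p'" "p = Suc p'"
proof -
  have "located (cs ! (p div 2)) (2 * (p div 2))"
    using assms by (auto simp: located_def prog_def)
  then show ?thesis
    using that by (cases "even p") (auto elim!: evenE oddE)
qed

text \<open>Covers every address in range, including second slots that a run never enters, so that
  the time bound needs no knowledge of the run.\<close>

lemma pc_step:
  assumes "pc a < length prog"
  shows "pc (step prog a) < length prog"
  using assms
proof (cases rule: pc_cases)
  case (1 c)
  note f = prog_fetch[OF 1]
  show ?thesis
  proof (cases c)
    case (Next s)
    then show ?thesis
      using 1 f prog_fetch(1)[OF located_Next[of s "pc a"]] by (cases "unread a") (simp_all add: step_def)
  next
    case (If_less i j c1 c2)
    then show ?thesis
      using f prog_fetch(1)[OF located_If_less(1)[OF 1[unfolded If_less]]] by (simp add: step_def)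
  qed (use f in \<open>simp_all add: step_def exec_instr_of\<close>)
next
  case (2 c p')
  note f = prog_fetch[OF 2(1)]
  show ?thesis
  proof (cases c)
    case (Do i c')
    then show ?thesis
      using 2 f prog_fetch(1)[OF located_Do[OF 2(1)[unfolded Do]]] by (simp add: step_def)
  next
    case (If_less i j c1 c2)
    then show ?thesis
      using 2 f prog_fetch(1)[OF located_If_less(2)[OF 2(1)[unfolded If_less]]] by (simp add: step_def)
  qed (use 2 f in \<open>simp_all add: step_def\<close>)
qed

lemma paused_pc:
  assumes "pc a < length prog"
  shows "\<exists>k\<le>Suc (2 * Max (code_height ` set cs)). paused ((step prog ^^ k) a)"
proof -
  have le: "\<exists>k\<le>2 * Max (code_height ` set cs). paused ((step prog ^^ k) a)" if loc: "located c (pc a)" for c a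
  proof -
    have "code_height c \<le> Max (code_height ` set cs)"
      using located_mem[OF loc] by (intro Max_ge) auto
    then have "2 * code_height c \<le> 2 * Max (code_height ` set cs)" by simp
    then show ?thesis
      using paused_located[OF loc] le_trans by blast
  qed
  show ?thesis
    using assms
  proof (cases rule: pc_cases)
    case (1 c)
    then show ?thesis using le[of c a] le_SucI by blast
  next
    case (2 c p')
    note f = prog_fetch[OF 2(1)]
    show ?thesis
    proof (cases c)
      case (Do i c')
      then show ?thesis
        using 2 f located_closed(1) by (intro paused_stepI le[of c']) (auto simp: step_def)
    next
      case (If_less i j c1 c2)
      then show ?thesis
        using 2 f located_closed(3) by (intro paused_stepI le[of c2]) (auto simp: step_def)
    next
      case (Next s)
      then show ?thesis using 2 f by (intro exI[of _ 0]) (auto simp: paused_def halted_def)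
    next
      case (Stop s)
      then show ?thesis using 2 f by (intro exI[of _ 0]) (auto simp: paused_def halted_def)
    qed
  qed
qed

text \<open>Rests on the program text alone: every loop passes through a \<open>Next\<close>. Each
  code costs at most two steps; the remaining 2 pay for starting in a second slot and for the strict
  inequality.\<close>

lemma prog_time:
  assumes "cs \<noteq> []"
  shows "time_per_letter_le prog w (2 * Max (code_height ` set cs) + 2)"
proof -
  have "pc (config_at prog w n) < length prog" for n
    using assms by (induction n) (simp_all add: config_at_def pc_step, simp add: prog_def)
  then have "\<exists>k\<le>Suc (2 * Max (code_height ` set cs)). paused (config_at prog w (n + k))" for n
    using paused_pc[of "config_at prog w n"]
    by (simp add: config_at_def funpow_add add.commute[of n])
  then show ?thesis
    unfolding time_per_letter_le_def paused_def by (metis add_2_eq_Suc' less_Suc_eq_le)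
qed

lemma prog_correct:
  assumes "runs I h b w (cs ! 0) (\<lambda>_. 0)" "cs \<noteq> []"
  shows "answers prog w b" "I (mem (config_at prog w n))"
proof -
  have "good I b \<lparr>pc = 0, mem = (\<lambda>_. 0), unread = w\<rparr>"
    using assms by (intro runs_good) (auto simp: located_def)
  then obtain N where N: "halted prog (config_at prog w N) b" "\<And>k. k \<le> N \<Longrightarrow> I (mem (config_at prog w k))"
    by (auto simp: good_def config_at_def)
  show "answers prog w b"
    using N(1) by (auto simp: answers_def)
  have "config_at prog w (N + k) = config_at prog w N" for k
  proof (induction k)
    case (Suc k)
    have "config_at prog w (N + Suc k) = step prog (config_at prog w (N + k))"
      by (simp add: config_at_def)
    with Suc show ?case
      using N(1) by (simp add: halted_def step_def)
  qed simp
  then show "I (mem (config_at prog w n))"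
    using N(2) by (metis le_add_diff_inverse nat_le_linear order_refl)
qed

end

text \<open>The program is obtained before \<open>I\<close>, \<open>b\<close> and \<open>w\<close>,
  so one program serves all inputs while the invariant may depend on the input size.\<close>

theorem code_compiles:
  fixes h :: "'s \<Rightarrow> 'l::finite option \<Rightarrow> 's code"
  assumes fin: "finite Q"
    and start: "\<And>s. Next s \<in> subcodes c0 \<Longrightarrow> s \<in> Q"
    and closed: "\<And>s l s'. s \<in> Q \<Longrightarrow> Next s' \<in> subcodes (h s l) \<Longrightarrow> s' \<in> Q"
  obtains P T where
    "\<And>w. time_per_letter_le P w T"
    "\<And>I b w. runs I h b w c0 (\<lambda>_. 0) \<Longrightarrow> answers P w b"
    "\<And>I b w n. runs I h b w c0 (\<lambda>_. 0) \<Longrightarrow> I (mem (config_at P w n))"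
proof -
  let ?C = "subcodes c0 \<union> (\<Union>s\<in>Q. \<Union>l. subcodes (h s l))"
  have "finite ?C"
    by (intro finite_UnI finite_UN_I finite_subcodes fin finite)
  from finite_list[OF this] obtain cs0 where cs0: "set cs0 = ?C" ..
  interpret code_list h "c0 # cs0"
  proof
    show "subcodes c \<subseteq> set (c0 # cs0)" if "c \<in> set (c0 # cs0)" for c
    proof
      fix c' assume c': "c' \<in> subcodes c"
      from that have "c \<in> ?C"
        using subcodes_refl[of c0] by (simp add: cs0) (elim disjE, simp_all)
      then show "c' \<in> set (c0 # cs0)"
        using subcodes_trans[OF c'] by (auto simp: cs0)
    qed
    show "h s l \<in> set (c0 # cs0)" if "Next s \<in> set (c0 # cs0)" for s l
    proof -
      have "Next s \<in> ?C"
        using that by (auto simp: cs0)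
      then have "s \<in> Q"
        using start closed by (elim UnE UN_E)
      then have "h s l \<in> ?C"
        by (intro UnI2 UN_I[of s] UN_I[of l]) simp_all
      then show ?thesis by (auto simp: cs0)
    qed
  qed
  show ?thesis
  proof (rule that)
    show "time_per_letter_le prog w (2 * Max (code_height ` set (c0 # cs0)) + 2)" for w
      by (rule prog_time) simp
    show "answers prog w b" if "runs I h b w c0 (\<lambda>_. 0)" for I b w
      using that by (intro prog_correct(1)[of I]) simp_all
    show "I (mem (config_at prog w n))" if "runs I h b w c0 (\<lambda>_. 0)" for I b w n
      using that by (intro prog_correct(2)[of I b]) simp_all
  qed
qed

section \<open>Right quotients of regular languages\<close>

text \<open>Having finitely many right quotients is the Myhill-Nerode condition for reading from
  right to left.\<close>

definition quot :: "'a list set \<Rightarrow> 'a list \<Rightarrow> 'a list set" where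
  "quot A w = {u. u @ w \<in> A}"

definition conc :: "'a list set \<Rightarrow> 'a list set \<Rightarrow> 'a list set" where
  "conc A B = {u @ v | u v. u \<in> A \<and> v \<in> B}"

lemma finite_range_quot_finite:
  assumes "finite A"
  shows "finite (range (quot A))"
proof (rule finite_subset)
  have "u \<in> (\<Union>v\<in>A. set (prefixes v))" if "u @ w \<in> A" for u w
    using that by (auto simp: prefix_def)
  then show "range (quot A) \<subseteq> Pow (\<Union>v\<in>A. set (prefixes v))"
    by (auto simp: quot_def)
  show "finite (Pow (\<Union>v\<in>A. set (prefixes v)))"
    using assms by simp
qed

lemma quot_Un: "quot (A \<union> B) w = quot A w \<union> quot B w"
  by (auto simp: quot_def)

lemma finite_range_quot_Un:
  assumes "finite (range (quot A))" "finite (range (quot B))"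
  shows "finite (range (quot (A \<union> B)))"
proof (rule finite_subset)
  show "range (quot (A \<union> B)) \<subseteq> (\<lambda>(X, Y). X \<union> Y) ` (range (quot A) \<times> range (quot B))"
    by (auto simp: quot_Un)
qed (use assms in simp)

text \<open>The cut before \<open>w\<close> falls into the factor from \<open>B\<close> or into the
  one from \<open>A\<close>; the second case contributes a union of quotients of
  \<open>A\<close>.\<close>

lemma quot_conc:
  "quot (conc A B) w = conc A (quot B w) \<union> \<Union> (quot A ` {p. \<exists>y\<in>B. w = p @ y})"
  by (auto simp: quot_def conc_def append_eq_append_conv2)

lemma finite_range_quot_conc:
  assumes "finite (range (quot A))" "finite (range (quot B))"
  shows "finite (range (quot (conc A B)))"
proof (rule finite_subset)
  show "range (quot (conc A B)) \<subseteq> (\<lambda>(X, F). conc A X \<union> \<Union> F) ` (range (quot B) \<times> Pow (range (quot A)))"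
  proof
    fix Z assume "Z \<in> range (quot (conc A B))"
    then obtain w where "Z = quot (conc A B) w" by blast
    then show "Z \<in> (\<lambda>(X, F). conc A X \<union> \<Union> F) ` (range (quot B) \<times> Pow (range (quot A)))"
      by (intro image_eqI[of _ _ "(quot B w, quot A ` {p. \<exists>y\<in>B. w = p @ y})"]) (auto simp: quot_conc)
  qed
qed (use assms in simp)

lemma concat_split:
  assumes "concat us = u @ w" "w \<noteq> []"
  shows "\<exists>us1 s p us2. us = us1 @ (s @ p) # us2 \<and> u = concat us1 @ s \<and> w = p @ concat us2"
  using assms
proof (induction us arbitrary: u)
  case (Cons v us)
  then consider z where "v = u @ z" "w = z @ concat us" | z where "u = v @ z" "concat us = z @ w"
    by (auto simp: append_eq_append_conv2)
  then show ?case
  proof cases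
    case (1 z)
    then show ?thesis
      by (intro exI[of _ "[]"] exI[of _ u] exI[of _ z] exI[of _ us]) simp
  next
    case (2 z)
    then obtain us1 s p us2 where
      "us = us1 @ (s @ p) # us2" "z = concat us1 @ s" "w = p @ concat us2"
      using Cons.IH Cons.prems by blast
    then show ?thesis
      using 2 by (intro exI[of _ "v # us1"] exI[of _ s] exI[of _ p] exI[of _ us2]) simp
  qed
qed simp

text \<open>The cut falls inside one factor \<open>s @ p\<close>. For empty \<open>w\<close> the
  list of factors may be empty and offer no such factor.\<close>

lemma quot_star:
  fixes A :: "'a list set"
  assumes "w \<noteq> []"
  defines "S \<equiv> {concat us | us. set us \<subseteq> A}"
  shows "quot S w = (\<Union>X \<in> quot A ` {p. \<exists>y\<in>S. w = p @ y}. conc S X)"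
proof (intro equalityI subsetI)
  fix u assume "u \<in> quot S w"
  then obtain us where us: "concat us = u @ w" "set us \<subseteq> A"
    by (auto simp: S_def quot_def)
  obtain us1 s p us2 where
    split: "us = us1 @ (s @ p) # us2" "u = concat us1 @ s" "w = p @ concat us2"
    using concat_split[OF us(1) assms(1)] by blast
  have "concat us1 \<in> S" "concat us2 \<in> S" "s \<in> quot A p"
    using us(2) by (auto simp: S_def quot_def split(1))
  then show "u \<in> (\<Union>X \<in> quot A ` {p. \<exists>y\<in>S. w = p @ y}. conc S X)"
    using split by (auto simp: conc_def)
next
  fix u assume "u \<in> (\<Union>X \<in> quot A ` {p. \<exists>y\<in>S. w = p @ y}. conc S X)"
  then obtain p us2 us1 s where
    *: "w = p @ concat us2" "set us2 \<subseteq> A" "u = concat us1 @ s" "set us1 \<subseteq> A" "s @ p \<in> A"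
    by (auto simp: conc_def S_def quot_def)
  then have "u @ w = concat (us1 @ (s @ p) # us2)"
    by simp
  moreover have "set (us1 @ (s @ p) # us2) \<subseteq> A"
    using * by simp
  ultimately show "u \<in> quot S w"
    unfolding S_def quot_def by blast
qed

lemma finite_range_quot_star:
  fixes A :: "'a list set"
  assumes "finite (range (quot A))"
  defines "S \<equiv> {concat us | us. set us \<subseteq> A}"
  shows "finite (range (quot S))"
proof (rule finite_subset)
  show "range (quot S) \<subseteq> insert (quot S []) ((\<lambda>F. \<Union>X\<in>F. conc S X) ` Pow (range (quot A)))"
  proof
    fix Z assume "Z \<in> range (quot S)"
    then obtain w where w: "Z = quot S w" by blast
    show "Z \<in> insert (quot S []) ((\<lambda>F. \<Union>X\<in>F. conc S X) ` Pow (range (quot A)))"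
    proof (cases "w = []")
      case True
      then show ?thesis using w by simp
    next
      case False
      show ?thesis
        unfolding w S_def quot_star[OF False] by (intro insertI2 imageI) blast
    qed
  qed
qed (use assms in simp)

lemma finite_range_quot_lang: "finite (range (quot (lang r)))"
proof (induction r)
  case (Alt r s)
  then show ?case by (simp add: finite_range_quot_Un)
next
  case (Seq r s)
  then show ?case using finite_range_quot_conc by (simp add: conc_def)
next
  case (Star r)
  then show ?case using finite_range_quot_star by simp
qed (simp_all add: finite_range_quot_finite)

text \<open>
  Words are read from right to left, as the labels of siblings become available in this order.
\<close>

theorem dtd_automaton:
  fixes D :: "'a::finite dtd"
  obtains K q0 and \<delta> :: "'a \<Rightarrow> nat \<Rightarrow> nat" and acc :: "nat \<Rightarrow> 'a \<Rightarrow> bool"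
  where "q0 \<le> K" "\<And>a q. \<delta> a q \<le> K" "\<And>w a. acc (foldr \<delta> w q0) a \<longleftrightarrow> w \<in> lang (D a)"
proof -
  \<comment> \<open>All content models run in parallel, because the control does not hold the label
    of the parent while its children are read.\<close>
  define state where "state w = (\<lambda>a. quot (lang (D a)) w)" for w
  have "range state \<subseteq> PiE UNIV (\<lambda>a. range (quot (lang (D a))))"
    by (auto simp: state_def)
  moreover have "finite (PiE UNIV (\<lambda>a. range (quot (lang (D a)))))"
    by (intro finite_PiE finite_range_quot_lang finite)
  ultimately have "finite (range state)"
    by (rule finite_subset)
  then obtain e :: "_ \<Rightarrow> nat" and K where e: "e ` range state = {i. i < K}" "inj_on e (range state)"
    using finite_imp_inj_to_nat_seg by metis
  define d where "d = the_inv_into (range state) e"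
  have d: "d (e (state w)) = state w" for w
    unfolding d_def using e(2) by (intro the_inv_into_f_f) auto
  have e_le: "e (state w) \<le> K" for w
    using e(1) by (auto intro!: less_imp_le)
  have step: "state (a # w) = (\<lambda>b. {u. u @ [a] \<in> state w b})" for a w
    by (auto simp: state_def quot_def)
  \<comment> \<open>\<open>min K\<close> only enforces the bound on numbers that encode no
    state.\<close>
  define \<delta> where "\<delta> a q = min K (e (\<lambda>b. {u. u @ [a] \<in> d q b}))" for a q
  define acc where "acc q a \<longleftrightarrow> [] \<in> d q a" for q a
  have "foldr \<delta> w (e (state [])) = e (state w)" for w
  proof (induction w)
    case (Cons a w)
    then show ?case
      using e_le[of "a # w"] by (simp add: \<delta>_def d step[symmetric] min_absorb2)
  qed simp
  then have "acc (foldr \<delta> w (e (state []))) a \<longleftrightarrow> w \<in> lang (D a)" for w a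
    by (simp add: acc_def d) (simp add: state_def quot_def)
  then show ?thesis
    using e_le by (intro that[of "e (state [])" K \<delta> acc]) (auto simp: \<delta>_def)
qed

section \<open>The abstract algorithm\<close>

text \<open>The last tag read; after a closing tag, the automaton state of the subtree just
  left.\<close>

datatype 'x control = Start | Opened 'x | Closed nat

text \<open>
  A store \<open>(d, B, E, R)\<close> consists of the current depth, the labels of the most recent nodes whose
  first subtree is being read, the values of first subtrees whose root was dropped from \<open>B\<close>,
  each with the depth of that root, and the number of times that \<open>B\<close> was cleared.
\<close>

type_synonym 'x store = "nat \<times> 'x list \<times> (nat \<times> nat) list \<times> nat"

text \<open>
  Reaching \<open>R\<close> clearings takes about \<open>R\<^sup>2 log R\<close> nodes, so that both \<open>E\<close>, with \<open>R\<close> numbers, and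
  \<open>B\<close>, with \<open>R log R\<close> letters, fit into the space bound; the size of the input is not needed.
\<close>

definition capacity :: "nat \<Rightarrow> nat" where
  "capacity R = R * floorlog 2 R"

text \<open>The labels discarded by the first \<open>R\<close> clearings, each of which finds
  \<open>B\<close> full; a lower bound on the nodes read so far.\<close>

definition pushes :: "nat \<Rightarrow> nat" where
  "pushes R = (\<Sum>i<R. capacity i)"

lemma pushes_0 [simp]: "pushes 0 = 0"
  by (simp add: pushes_def)

lemma pushes_Suc [simp]: "pushes (Suc R) = pushes R + capacity R"
  by (simp add: pushes_def)

inductive binary :: "'x utree \<Rightarrow> bool" where
  "binary (Branch x [])"
| "binary l \<Longrightarrow> binary r \<Longrightarrow> binary (Branch x [l, r])"

locale automaton =
  fixes \<delta> :: "'x \<Rightarrow> nat \<Rightarrow> nat" and acc :: "nat \<Rightarrow> 'x \<Rightarrow> bool" and q0 :: nat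
begin

text \<open>Acts before an opening tag. After \<open>Opened y\<close> the first subtree of
  \<open>y\<close> begins; on overflow \<open>y\<close> is lost with the rest. After
  \<open>Closed q\<close> the first subtree of a node at depth \<open>d\<close> has ended.\<close>

fun arrive :: "'x control \<Rightarrow> 'x store \<Rightarrow> 'x store option" where
  "arrive Start \<sigma> = Some \<sigma>"
| "arrive (Opened y) (d, B, E, R) =
     Some (if length B < capacity R then (d, y # B, E, R) else (d, [], E, Suc R))"
| "arrive (Closed q) (d, B, E, R) =
     (case B of
        [] \<Rightarrow> Some (d, [], (d, q) # E, R)
      | y # B' \<Rightarrow> if acc q y then Some (d, B', E, R) else None)"

text \<open>With \<open>e < d\<close> the top of \<open>E\<close> belongs to a proper ancestor;
  otherwise the node being closed stored it.\<close>

fun leave :: "'x control \<Rightarrow> 'x \<Rightarrow> 'x store \<Rightarrow> (nat \<times> 'x store) option" where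
  "leave Start x \<sigma> = None"
| "leave (Opened y) x (d, B, E, R) = (if acc q0 x then Some (\<delta> x q0, (d - 1, B, E, R)) else None)"
| "leave (Closed q) x (d, B, E, R) =
     (case E of
        [] \<Rightarrow> Some (\<delta> x q, (d - 1, B, E, R))
      | (e, q') # E' \<Rightarrow>
          if e < d then Some (\<delta> x q, (d - 1, B, E, R))
          else if acc q' x then Some (\<delta> x q, (d - 1, B, E', R))
          else None)"

fun advance :: "'x control \<Rightarrow> 'x store \<Rightarrow> 'x tag \<Rightarrow> ('x control \<times> 'x store) option" where
  "advance c \<sigma> (Opening x) = map_option (\<lambda>(d, BER). (Opened x, (Suc d, BER))) (arrive c \<sigma>)"
| "advance c \<sigma> (Closing x) = map_option (\<lambda>(q, \<sigma>). (Closed q, \<sigma>)) (leave c x \<sigma>)"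

text \<open>Carries the expected answer and a demand on every store passed, so that correctness and
  space come from one induction.\<close>

fun accepts :: "('x store \<Rightarrow> bool) \<Rightarrow> bool \<Rightarrow> 'x control \<Rightarrow> 'x store \<Rightarrow> 'x tag list \<Rightarrow> bool" where
  "accepts I b c \<sigma> [] \<longleftrightarrow> I \<sigma> \<and> b"
| "accepts I b c \<sigma> (x # w) \<longleftrightarrow> I \<sigma> \<and>
     (case advance c \<sigma> x of None \<Rightarrow> \<not> b | Some (c', \<sigma>') \<Rightarrow> accepts I b c' \<sigma>' w)"

definition fits :: "nat \<Rightarrow> 'x store \<Rightarrow> bool" where
  "fits M = (\<lambda>(d, B, E, R). d \<le> M \<and> pushes R + length B \<le> M \<and> length B \<le> capacity R \<and> length E \<le> R)"

fun state :: "'x utree \<Rightarrow> nat" where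
  "state (Branch x [l, r]) = \<delta> x (state r)"
| "state (Branch x ts) = \<delta> x q0"

fun accepted :: "'x utree \<Rightarrow> bool" where
  "accepted (Branch x [l, r]) \<longleftrightarrow> acc (state l) x \<and> accepted l \<and> accepted r"
| "accepted (Branch x ts) \<longleftrightarrow> acc q0 x"

lemma XML_hd_tl: "XML t = Opening (label t) # tl (XML t)"
  by (cases t) simp

text \<open>
  The store is restored by a subtree, except that \<open>B\<close> may have been cleared. Hence a node is
  dropped from \<open>B\<close> only by clearing \<open>B\<close> within its first subtree, and as those of the nodes on
  \<open>E\<close> are disjoint, \<open>E\<close> is not longer than the number of these events.
\<close>

lemma accepts_subtree:
  assumes "binary t" "d + num_nodes t \<le> Suc M" "pushes R + length B + num_nodes t \<le> M"
    "length B \<le> capacity R" "length E \<le> R" "\<And>e q. (e, q) \<in> set E \<Longrightarrow> e < d"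
    "\<not> accepted t \<Longrightarrow> \<not> b"
    "\<And>B' R'. accepted t \<Longrightarrow> R' = R \<and> B' = B \<or> R < R' \<and> B' = [] \<Longrightarrow>
       pushes R' + length B' \<le> pushes R + length B + num_nodes t \<Longrightarrow>
       accepts (fits M) b (Closed (state t)) (d - 1, B', E, R') w"
  shows "accepts (fits M) b (Opened (label t)) (d, B, E, R) (tl (XML t) @ w)"
  using assms
proof (induction t arbitrary: d B E R w rule: binary.induct)
  case (1 x)
  then show ?case
    by (auto simp: fits_def)
next
  case (2 l r x)
  define B1 where "B1 = (if length B < capacity R then x # B else [])"
  define R1 where "R1 = (if length B < capacity R then R else Suc R)"
  note prems = "2.prems"
  \<comment> \<open>A clearing preserves the potential, since \<open>length B = capacity R\<close>
    is then moved into \<open>pushes (Suc R)\<close>.\<close>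
  have 1: "pushes R1 + length B1 \<le> Suc (pushes R + length B)" "length B1 \<le> capacity R1"
      "length E \<le> R1" "R \<le> R1"
    using prems by (auto simp: B1_def R1_def)
  have start: "accepts (fits M) b (Opened (label l)) (Suc d, B1, E, R1)
      (tl (XML l) @ XML r @ Closing x # w)"
  proof (rule "2.IH"(1))
    show "Suc d + num_nodes l \<le> Suc M" "pushes R1 + length B1 + num_nodes l \<le> M"
      using prems 1 by auto
    show "e < Suc d" if "(e, q) \<in> set E" for e q
      using prems(5)[OF that] by simp
    show "\<not> b" if "\<not> accepted l"
      using that prems(6) by simp
    fix B2 R2
    assume l: "accepted l" and BR2: "R2 = R1 \<and> B2 = B1 \<or> R1 < R2 \<and> B2 = []"
      and le2: "pushes R2 + length B2 \<le> pushes R1 + length B1 + num_nodes l"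
    have fits: "fits M (d, B2, E, R2)"
      using prems 1 BR2 le2 by (auto simp: fits_def)
    have "accepts (fits M) b (Closed (state l)) (d, B2, E, R2)
      (Opening (label r) # tl (XML r) @ Closing x # w)"
    proof (cases B2)
      case Nil
      \<comment> \<open>An empty \<open>B2\<close> witnesses a clearing, at \<open>x\<close> itself
        or inside \<open>l\<close>; it pays for the new entry of \<open>E\<close>.\<close>
      then have R2: "R < R2"
        using BR2 1 by (auto simp: B1_def R1_def split: if_splits)
      have "accepts (fits M) b (Opened (label r)) (Suc d, B2, (d, state l) # E, R2) (tl (XML r) @ Closing x # w)"
      proof (rule "2.IH"(2))
        show "Suc d + num_nodes r \<le> Suc M" "pushes R2 + length B2 + num_nodes r \<le> M"
          using prems 1 le2 Nil by auto
        show "length B2 \<le> capacity R2" using Nil by simp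
        show "length ((d, state l) # E) \<le> R2"
          using R2 prems by simp
        show "e < Suc d" if "(e, q) \<in> set ((d, state l) # E)" for e q
          using prems(5) that by fastforce
        show "\<not> b" if "\<not> accepted r"
          using that prems(6) by simp
        fix B3 R3
        assume r: "accepted r" and BR3: "R3 = R2 \<and> B3 = B2 \<or> R2 < R3 \<and> B3 = []"
          and le3: "pushes R3 + length B3 \<le> pushes R2 + length B2 + num_nodes r"
        have "fits M (d, [], (d, state l) # E, R3)"
          using R2 prems 1 BR3 le2 le3 Nil by (auto simp: fits_def)
        moreover have "accepts (fits M) b (Closed (\<delta> x (state r))) (d - Suc 0, [], E, R3) w" if "acc (state l) x"
          using prems(7)[of R3 "[]"] l r that R2 BR3 le2 le3 1 Nil by auto
        ultimately show "accepts (fits M) b (Closed (state r)) (Suc d - 1, B3, (d, state l) # E, R3) (Closing x # w)"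
          using BR3 prems(6) Nil by auto
      qed
      then show ?thesis
        using Nil fits by simp
    next
      case (Cons y B')
      then have B2: "B2 = x # B" "R2 = R"
        using BR2 by (auto simp: B1_def R1_def split: if_splits)
      have "accepts (fits M) b (Opened (label r)) (Suc d, B, E, R) (tl (XML r) @ Closing x # w)"
        if x: "acc (state l) x"
      proof (rule "2.IH"(2))
        show "Suc d + num_nodes r \<le> Suc M" "pushes R + length B + num_nodes r \<le> M"
          using prems by auto
        show "length B \<le> capacity R" "length E \<le> R"
          using prems by auto
        show "e < Suc d" if "(e, q) \<in> set E" for e q
          using prems(5)[OF that] by simp
        show "\<not> b" if "\<not> accepted r"
          using that prems(6) by simp
        fix B3 R3
        assume r: "accepted r" and BR3: "R3 = R \<and> B3 = B \<or> R < R3 \<and> B3 = []"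
          and le3: "pushes R3 + length B3 \<le> pushes R + length B + num_nodes r"
        have "fits M (d, B3, E, R3)"
          using prems BR3 le3 by (auto simp: fits_def)
        moreover have "accepts (fits M) b (Closed (\<delta> x (state r))) (d - Suc 0, B3, E, R3) w"
          using prems(7)[of R3 B3] l r x BR3 le3 by auto
        ultimately show "accepts (fits M) b (Closed (state r)) (Suc d - 1, B3, E, R3) (Closing x # w)"
          \<comment> \<open>All entries of \<open>E\<close> have depth below \<open>d\<close>, so
            closing \<open>x\<close> takes none of them.\<close>
          using prems(5)[of "fst (hd E)" "snd (hd E)"] by (auto split: list.split)
      qed
      then show ?thesis
        using fits B2 prems(6) by auto
    qed
    then show "accepts (fits M) b (Closed (state l)) (Suc d - 1, B2, E, R2) (XML r @ Closing x # w)"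
      by (subst XML_hd_tl) simp
  qed (use 1 in simp_all)
  have "fits M (d, B, E, R)"
    using prems by (auto simp: fits_def)
  then have "accepts (fits M) b (Opened x) (d, B, E, R)
      (Opening (label l) # tl (XML l) @ XML r @ Closing x # w)"
    using start by (auto simp: B1_def R1_def)
  moreover have "tl (XML (Branch x [l, r])) @ w = Opening (label l) # tl (XML l) @ XML r @ Closing x # w"
    by (simp, subst XML_hd_tl) simp
  ultimately show ?case
    by (simp only: utree.sel)
qed

theorem accepts_XML:
  assumes "binary t" "num_nodes t \<le> M"
  shows "accepts (fits M) (accepted t) Start (0, [], [], 0) (XML t)"
proof -
  have "accepts (fits M) (accepted t) (Opened (label t)) (1, [], [], 0) (tl (XML t) @ [])"
    using assms by (intro accepts_subtree) (auto simp: fits_def)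
  then show ?thesis
    by (subst XML_hd_tl) (simp add: fits_def)
qed

end

section \<open>Padded FCNS trees and validity\<close>

fun on_option :: "'b \<Rightarrow> ('a \<Rightarrow> 'b) \<Rightarrow> 'a option \<Rightarrow> 'b" where
  "on_option b f None = b"
| "on_option b f (Some a) = f a"

fun spine :: "'a tree \<Rightarrow> 'a list" where
  "spine Leaf = []"
| "spine (Node l a r) = a # spine r"

fun valid_tree :: "'a dtd \<Rightarrow> 'a tree \<Rightarrow> bool" where
  "valid_tree D Leaf \<longleftrightarrow> True"
| "valid_tree D (Node l a r) \<longleftrightarrow> spine l \<in> lang (D a) \<and> valid_tree D l \<and> valid_tree D r"

lemma spine_FCNS_siblings: "spine (FCNS_siblings ts) = map label ts"
  by (induction ts rule: FCNS_siblings.induct) simp_all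

lemma valid_tree_FCNS_siblings: "valid_tree D (FCNS_siblings ts) \<longleftrightarrow> (\<forall>t\<in>set ts. valid D t)"
  by (induction ts rule: FCNS_siblings.induct) (simp_all add: spine_FCNS_siblings)

lemma size_FCNS_siblings: "size (FCNS_siblings ts) = (\<Sum>t\<leftarrow>ts. num_nodes t)"
  by (induction ts rule: FCNS_siblings.induct) simp_all

lemma binary_add_bot: "binary (add_bot t)"
  by (induction t) (simp_all add: binary.intros)

lemma num_nodes_add_bot: "num_nodes (add_bot t) \<le> 2 * size t + 1"
  by (induction t) auto

lemma FCNS_bot_simps:
  shows "binary (FCNS_bot t)" "num_nodes (FCNS_bot t) \<le> 2 * num_nodes t + 1"
  using num_nodes_add_bot[of "FCNS t"]
  by (simp_all add: FCNS_bot_def binary_add_bot FCNS_def size_FCNS_siblings)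

locale dtd_states =
  fixes D :: "'a dtd" and \<delta> :: "'a \<Rightarrow> nat \<Rightarrow> nat" and acc :: "nat \<Rightarrow> 'a \<Rightarrow> bool" and q0 :: nat
  assumes acc_foldr: "acc (foldr \<delta> w q0) a \<longleftrightarrow> w \<in> lang (D a)"
begin

text \<open>The label \<open>None\<close> has the state of the empty sibling list and passes every
  check, so a padding leaf acts like an absent subtree.\<close>

sublocale automaton
  "on_option (\<lambda>_. q0) \<delta>" "\<lambda>q. on_option True (acc q)" q0 .

lemma state_add_bot: "state (add_bot t) = foldr \<delta> (spine t) q0"
  by (induction t) auto

lemma accepted_add_bot: "accepted (add_bot t) \<longleftrightarrow> valid_tree D t"
  by (induction t) (use acc_foldr[of "[]"] in \<open>auto simp: state_add_bot acc_foldr\<close>)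

lemma accepted_FCNS_bot: "accepted (FCNS_bot t) \<longleftrightarrow> valid D t"
  by (simp add: FCNS_bot_def FCNS_def accepted_add_bot valid_tree_FCNS_siblings
      del: FCNS_siblings.simps)

end

section \<open>Implementation\<close>

text \<open>Lets the machine update the capacity with one comparison per clearing instead of
  computing a logarithm.\<close>

lemma floorlog_Suc:
  "floorlog 2 (Suc R) = (if Suc R < 2 ^ floorlog 2 R then floorlog 2 R else Suc (floorlog 2 R))"
proof -
  have "R < 2 ^ floorlog 2 R"
    using floorlog_bounds[of R 2] by (cases "R = 0") simp_all
  then show ?thesis
    using floorlog_leI[of "Suc R" 2 "floorlog 2 R"] floorlog_leI[of "Suc R" 2 "Suc (floorlog 2 R)"]
      floorlog_ge_SucI[of 2 "floorlog 2 R" "Suc R"] floorlog_mono[of R "Suc R" 2]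
    by (auto intro: antisym)
qed

text \<open>
  Memory layout for a store \<open>(d, B, E, R)\<close>. The cells 0 and 1 are scratch; 2 and 3 hold the first
  free addresses of the stacks \<open>B\<close> and \<open>E\<close>; 4 holds \<open>d\<close> and 5 holds \<open>R\<close>; 6 holds the address
  where \<open>B\<close> is full; 7 and 8 hold \<open>floorlog 2 R\<close> and its power of two. From cell 9 on, the stacks
  are interleaved: the \<open>i\<close>-th label is in cell \<open>9 + 3 i\<close>, the \<open>i\<close>-th depth and value are in the
  cells \<open>10 + 3 i\<close> and \<open>11 + 3 i\<close>.
\<close>

definition incr :: "nat \<Rightarrow> nat \<Rightarrow> 's code \<Rightarrow> 's code" where
  "incr r k c = Do (Set 1 k) (Do (Calc Add r r 1) c)"

definition decr :: "nat \<Rightarrow> nat \<Rightarrow> 's code \<Rightarrow> 's code" where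
  "decr r k c = Do (Set 1 k) (Do (Calc Sub r r 1) c)"

text \<open>Turns the number in cell 0, at most \<open>n\<close>, into a choice of code. The chain
  is used with the fixed \<open>K\<close>, hence in constant time; it overwrites cell 1.\<close>

fun branch :: "nat \<Rightarrow> (nat \<Rightarrow> 's code) \<Rightarrow> 's code" where
  "branch 0 f = f 0"
| "branch (Suc n) f = Do (Set 1 n) (If_less 1 0 (f (Suc n)) (branch n f))"

definition set_limit :: "'s code \<Rightarrow> 's code" where
  "set_limit c =
     Do (Calc Mul 0 5 7) (Do (Set 1 3) (Do (Calc Mul 0 0 1) (Do (Set 1 9) (Do (Calc Add 6 0 1) c))))"

text \<open>Only the pointer is reset; stale labels stay in memory.\<close>

definition clear_labels :: "'s code \<Rightarrow> 's code" where
  "clear_labels c = Do (Set 2 9) (incr 5 1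
     (If_less 5 8 (set_limit c) (Do (Calc Add 8 8 8) (incr 7 1 (set_limit c)))))"

definition push_label :: "nat \<Rightarrow> 's code \<Rightarrow> 's code" where
  "push_label n c = If_less 2 6 (Do (Set 0 n) (Do (Put 2 0) (incr 2 3 c))) (clear_labels c)"

definition push_entry :: "nat \<Rightarrow> 's code \<Rightarrow> 's code" where
  "push_entry q c =
     Do (Set 1 1) (Do (Calc Add 0 3 1) (Do (Put 0 4)
     (Do (Calc Add 0 0 1) (Do (Set 1 q) (Do (Put 0 1) (incr 3 3 c))))))"

locale coding = automaton \<delta> acc q0
  for \<delta> :: "'x \<Rightarrow> nat \<Rightarrow> nat" and acc q0 +
  fixes code :: "'x \<Rightarrow> nat" and decode :: "nat \<Rightarrow> 'x" and K :: nat
  assumes code_le: "code x \<le> K" and decode_code: "decode (code x) = x"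
    and q0_le: "q0 \<le> K" and \<delta>_le: "\<delta> x q \<le> K"
begin

definition check :: "bool \<Rightarrow> 's code \<Rightarrow> 's code" where
  "check p c = (if p then c else Stop False)"

definition enter :: "'x \<Rightarrow> 'x control code" where
  "enter x = incr 4 1 (Next (Opened x))"

definition exit :: "nat \<Rightarrow> 'x \<Rightarrow> 'x control code" where
  "exit q x = decr 4 1 (Next (Closed (\<delta> x q)))"

definition pop_label :: "nat \<Rightarrow> 's code \<Rightarrow> 's code" where
  "pop_label q c =
     Do (Set 0 9) (If_less 0 2
       (decr 2 3 (Do (Fetch 0 2) (branch K (\<lambda>n. check (acc q (decode n)) c))))
       (push_entry q c))"

definition pop_entry :: "'x \<Rightarrow> 's code \<Rightarrow> 's code" where
  "pop_entry x c =
     Do (Set 1 1) (Do (Calc Sub 0 3 1) (Do (Fetch 0 0) (decr 3 3 (branch K (\<lambda>q. check (acc q x) c)))))"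

definition settle :: "'x \<Rightarrow> 's code \<Rightarrow> 's code" where
  "settle x c =
     Do (Set 0 9) (If_less 0 3
       (Do (Set 1 2) (Do (Calc Sub 0 3 1) (Do (Fetch 0 0) (If_less 0 4 c (pop_entry x c)))))
       c)"

fun handler :: "'x control \<Rightarrow> 'x tag option \<Rightarrow> 'x control code" where
  "handler c None = Stop True"
| "handler Start (Some (Opening x)) = enter x"
| "handler (Opened y) (Some (Opening x)) = push_label (code y) (enter x)"
| "handler (Closed q) (Some (Opening x)) = pop_label q (enter x)"
| "handler Start (Some (Closing x)) = Stop False"
| "handler (Opened y) (Some (Closing x)) = check (acc q0 x) (exit q0 x)"
| "handler (Closed q) (Some (Closing x)) = settle x (exit q x)"

text \<open>The empty store: \<open>capacity 0\<close> is 0, so cell 6 equals the base address and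
  the first inner node already clears; cell 8 holds the power \<open>2 ^ 0\<close>.\<close>

definition start :: "'x control code" where
  "start = Do (Set 2 9) (Do (Set 3 9) (Do (Set 6 9) (Do (Set 8 1) (Next Start))))"

fun labels :: "(nat \<Rightarrow> nat) \<Rightarrow> 'x list \<Rightarrow> bool" where
  "labels m [] \<longleftrightarrow> True"
| "labels m (y # B) \<longleftrightarrow> m (9 + 3 * length B) = code y \<and> labels m B"

fun entries :: "(nat \<Rightarrow> nat) \<Rightarrow> (nat \<times> nat) list \<Rightarrow> bool" where
  "entries m [] \<longleftrightarrow> True"
| "entries m ((e, q) # E) \<longleftrightarrow>
     m (10 + 3 * length E) = e \<and> m (11 + 3 * length E) = q \<and> q \<le> K \<and> entries m E"

lemma labels_cong: "(\<And>i. i < length B \<Longrightarrow> m (9 + 3 * i) = m' (9 + 3 * i)) \<Longrightarrow> labels m B = labels m' B"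
  by (induction B) auto

lemma entries_cong:
  "(\<And>i. i < length E \<Longrightarrow> m (10 + 3 * i) = m' (10 + 3 * i) \<and> m (11 + 3 * i) = m' (11 + 3 * i)) \<Longrightarrow>
   entries m E = entries m' E"
  by (induction E rule: entries.induct[of _ "m"]) auto

lemma labels_upd [simp]:
  "j < 9 \<Longrightarrow> labels (m(j := v)) B = labels m B"
  "length B \<le> k \<Longrightarrow> labels (m(9 + 3 * k := v)) B = labels m B"
  "labels (m(10 + 3 * k := v)) B = labels m B"
  "labels (m(11 + 3 * k := v)) B = labels m B"
  by (rule labels_cong, simp, presburger?)+

lemma entries_upd [simp]:
  "j < 9 \<Longrightarrow> entries (m(j := v)) E = entries m E"
  "entries (m(9 + 3 * k := v)) E = entries m E"
  "length E \<le> k \<Longrightarrow> entries (m(10 + 3 * k := v)) E = entries m E"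
  "length E \<le> k \<Longrightarrow> entries (m(11 + 3 * k := v)) E = entries m E"
  by (rule entries_cong, simp, presburger?)+

fun represents :: "'x store \<Rightarrow> (nat \<Rightarrow> nat) \<Rightarrow> bool" where
  "represents (d, B, E, R) m \<longleftrightarrow>
     m 2 = 9 + 3 * length B \<and> m 3 = 9 + 3 * length E \<and> m 4 = d \<and> m 5 = R \<and>
     m 6 = 9 + 3 * capacity R \<and> m 7 = floorlog 2 R \<and> m 8 = 2 ^ floorlog 2 R \<and>
     labels m B \<and> entries m E"

end

section \<open>Simulation of the abstract algorithm within memory bounds\<close>

locale bounded_coding = coding +
  fixes M V X Z :: nat
  assumes resets_le: "pushes R \<le> M \<Longrightarrow> R \<le> X"
    and capacity_le: "R \<le> X \<Longrightarrow> capacity R \<le> Z"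
    and power_le: "R \<le> X \<Longrightarrow> 2 ^ floorlog 2 R \<le> V"
    and X_le: "X \<le> Z" and Z_le: "12 + 3 * Z \<le> V" and M_le: "M \<le> V" and K_le: "K \<le> V"
begin

text \<open>Here \<open>M\<close> bounds nodes and depths, \<open>X\<close> clearings,
  \<open>Z\<close> the length of either stack and \<open>V\<close> all integers. Interleaving leaves
  depth cells beyond the first \<open>X\<close> idle; they are charged like states.\<close>

definition cell_bound :: "nat \<Rightarrow> nat" where
  "cell_bound j =
     (if j < 9 then V
      else if j \<ge> 9 + 3 * Z then 0
      else if j mod 3 = 1 \<and> j < 9 + 3 * X then M
      else K)"

lemma cell_bound_simps [simp]:
  "j < 9 \<Longrightarrow> cell_bound j = V"
  "k < Z \<Longrightarrow> cell_bound (9 + 3 * k) = K"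
  "k < X \<Longrightarrow> cell_bound (10 + 3 * k) = M"
  "k < Z \<Longrightarrow> cell_bound (11 + 3 * k) = K"
proof -
  have "(9 + 3 * k) mod 3 = 0" "(10 + 3 * k) mod 3 = 1" "(11 + 3 * k) mod 3 = 2"
    by presburger+
  then show "j < 9 \<Longrightarrow> cell_bound j = V"
    "k < Z \<Longrightarrow> cell_bound (9 + 3 * k) = K"
    "k < X \<Longrightarrow> cell_bound (10 + 3 * k) = M"
    "k < Z \<Longrightarrow> cell_bound (11 + 3 * k) = K"
    using X_le by (simp_all add: cell_bound_def)
qed

definition bounded :: "(nat \<Rightarrow> nat) \<Rightarrow> bool" where
  "bounded m \<longleftrightarrow> (\<forall>j. m j \<le> cell_bound j)"

lemma bounded_upd [simp]: "bounded m \<Longrightarrow> v \<le> cell_bound j \<Longrightarrow> bounded (m(j := v))"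
  by (simp add: bounded_def)

abbreviation run :: "bool \<Rightarrow> 'a tag list \<Rightarrow> 'a control code \<Rightarrow> (nat \<Rightarrow> nat) \<Rightarrow> bool" where
  "run \<equiv> runs bounded handler"

lemma run_branch:
  assumes "bounded m" "m 0 \<le> n" "n \<le> V" "\<And>v. v \<le> V \<Longrightarrow> run b w (f (m 0)) (m(1 := v))"
  shows "run b w (branch n f) m"
  using assms
proof (induction n arbitrary: m)
  case 0
  then have "m 1 \<le> V"
    using cell_bound_simps(1)[of 1] by (metis bounded_def one_less_numeral_iff semiring_norm(77))
  then show ?case using 0 by (metis branch.simps(1) fun_upd_triv le_zero_eq)
next
  case (Suc n)
  have b: "bounded (m(1 := n))"
    using Suc.prems(1,3) by simp
  have "run b w (branch n f) (m(1 := n))" if "m 0 \<le> n"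
    using b
  proof (rule Suc.IH)
    show "run b w (f ((m(1 := n)) 0)) ((m(1 := n))(1 := v))" if "v \<le> V" for v
    proof -
      have "run b w (f (m 0)) (m(1 := v))"
        by (rule Suc.prems(4)[OF that])
      then show ?thesis by simp
    qed
  qed (use Suc.prems(3) that in simp_all)
  moreover have "run b w (f (m 0)) (m(1 := n))"
    using Suc.prems(3) by (intro Suc.prems(4)) simp
  ultimately show ?case
    using Suc.prems(1,2) b by (cases "m 0 = Suc n") simp_all
qed

lemma run_set_limit:
  assumes "bounded m" "m 5 = R" "m 7 = floorlog 2 R" "R \<le> X"
    "\<And>u v. u \<le> V \<Longrightarrow> v \<le> V \<Longrightarrow> run b w c (m(0 := u, 1 := v, 6 := 9 + 3 * capacity R))"
  shows "run b w (set_limit c) m"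
proof -
  have "capacity R \<le> Z"
    using assms(4) by (rule capacity_le)
  then show ?thesis
    using assms Z_le
    by (simp add: set_limit_def capacity_def[symmetric] mult.commute[of _ 3] add.commute[of _ 9])
qed

lemma run_clear_labels:
  assumes "bounded m" "represents (d, B, E, R) m" "Suc R \<le> X"
    "\<And>m'. bounded m' \<Longrightarrow> represents (d, [], E, Suc R) m' \<Longrightarrow> run b w c m'"
  shows "run b w (clear_labels c) m"
proof -
  have "Suc R \<le> V" "2 ^ floorlog 2 (Suc R) \<le> V" "capacity (Suc R) \<le> Z"
    "floorlog 2 (Suc R) \<le> V"
    using power_le[OF assms(3)] assms(3) capacity_le[OF assms(3)] X_le Z_le
      less_exp[of "floorlog 2 (Suc R)"] by linarith+
  then show ?thesis
    using assms Z_le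
    by (auto simp: clear_labels_def incr_def floorlog_Suc intro!: run_set_limit[of _ "Suc R"]
        assms(4) split: if_splits)
qed

lemma run_enter:
  assumes "bounded m" "represents (d, B, E, R) m" "Suc d \<le> M"
    "\<And>m'. bounded m' \<Longrightarrow> represents (Suc d, B, E, R) m' \<Longrightarrow> run b w (Next (Opened x)) m'"
  shows "run b w (enter x) m"
  using assms Z_le M_le by (auto simp: enter_def incr_def intro!: assms(4))

lemma run_exit:
  assumes "bounded m" "represents (d, B, E, R) m"
    "\<And>m'. bounded m' \<Longrightarrow> represents (d - 1, B, E, R) m' \<Longrightarrow> run b w (Next (Closed (\<delta> x q))) m'"
  shows "run b w (exit q x) m"
proof -
  have "d \<le> V"
    using assms(1)[unfolded bounded_def, rule_format, of 4] assms(2) by simp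
  then show ?thesis
    using assms Z_le M_le by (auto simp: exit_def decr_def intro!: assms(3))
qed

lemma run_check:
  "p \<and> run b w c m \<or> \<not> p \<and> bounded m \<and> \<not> b \<Longrightarrow> run b w (check p c) m"
  by (auto simp: check_def)

lemma run_push_label:
  assumes "bounded m" "represents (d, B, E, R) m" "length B \<le> capacity R" "R \<le> X"
    "length B \<ge> capacity R \<Longrightarrow> Suc R \<le> X"
    "\<And>m'. bounded m' \<Longrightarrow>
       represents (if length B < capacity R then (d, y # B, E, R) else (d, [], E, Suc R)) m' \<Longrightarrow>
       run b w c m'"
  shows "run b w (push_label (code y) c) m"
proof (cases "length B < capacity R")
  case True
  have "length B < Z"
    using True capacity_le[OF assms(4)] by simp
  then show ?thesis
    using True assms(1,2) Z_le code_le[of y] K_le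
    by (auto simp: push_label_def incr_def intro!: assms(6))
next
  case False
  then have "run b w (clear_labels c) m"
    using assms by (intro run_clear_labels[of m d B E R]) auto
  then show ?thesis
    using False assms(1,2) by (auto simp: push_label_def)
qed

lemma run_push_entry:
  assumes "bounded m" "represents (d, B, E, R) m" "length E < X" "d \<le> M" "q \<le> K"
    "\<And>m'. bounded m' \<Longrightarrow> represents (d, B, (d, q) # E, R) m' \<Longrightarrow> run b w c m'"
  shows "run b w (push_entry q c) m"
  using assms(1-5) X_le Z_le M_le K_le
  by (auto simp: push_entry_def incr_def simp del: One_nat_def intro!: assms(6))

lemma run_pop_label:
  assumes "bounded m" "represents (d, B, E, R) m" "d \<le> M" "q \<le> K"
    "B = [] \<Longrightarrow> length E < X"
    "B \<noteq> [] \<Longrightarrow> \<not> acc q (hd B) \<Longrightarrow> \<not> b"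
    "\<And>m'. bounded m' \<Longrightarrow> B = [] \<Longrightarrow> represents (d, [], (d, q) # E, R) m' \<Longrightarrow> run b w c m'"
    "\<And>m'. bounded m' \<Longrightarrow> B \<noteq> [] \<Longrightarrow> acc q (hd B) \<Longrightarrow> represents (d, tl B, E, R) m' \<Longrightarrow> run b w c m'"
  shows "run b w (pop_label q c) m"
proof (cases B)
  case Nil
  let ?m = "m(0 := 9)"
  have "run b w (push_entry q c) ?m"
    using assms Nil Z_le by (intro run_push_entry[of _ d B E R]) auto
  then show ?thesis
    using Nil assms(1,2) Z_le by (auto simp: pop_label_def)
next
  case (Cons y B')
  let ?m = "m(1 := 3, 2 := 9 + 3 * length B', 0 := code y)"
  have len: "9 + 3 * length B' \<le> V"
    using assms(1)[unfolded bounded_def, rule_format, of 2] assms(2) Cons by simp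
  have b: "bounded ?m"
    using assms(1) len Z_le code_le[of y] K_le by simp
  have "run b w (branch K (\<lambda>n. check (acc q (decode n)) c)) ?m"
  proof (rule run_branch[OF b])
    fix v assume v: "v \<le> V"
    have bv: "bounded (?m(1 := v))"
      using b by (rule bounded_upd) (use v in simp)
    moreover have "run b w c (?m(1 := v))" if "acc q y"
      using bv that assms(2) Cons by (intro assms(8)) auto
    ultimately show "run b w (check (acc q (decode (?m 0))) c) (?m(1 := v))"
      using assms(6) Cons by (auto simp: decode_code intro!: run_check)
  qed (use code_le K_le in simp_all)
  then show ?thesis
    using Cons assms(1,2) Z_le len by (auto simp: pop_label_def decr_def)
qed

lemma run_settle:
  assumes "bounded m" "represents (d, B, E, R) m"
    "\<And>m'. bounded m' \<Longrightarrow> represents (d, B, E, R) m' \<Longrightarrow>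
       E = [] \<or> fst (hd E) < d \<Longrightarrow> run b w c m'"
    "\<And>m'. bounded m' \<Longrightarrow> E \<noteq> [] \<Longrightarrow> \<not> fst (hd E) < d \<Longrightarrow> acc (snd (hd E)) x \<Longrightarrow>
       represents (d, B, tl E, R) m' \<Longrightarrow> run b w c m'"
    "E \<noteq> [] \<Longrightarrow> \<not> fst (hd E) < d \<Longrightarrow> \<not> acc (snd (hd E)) x \<Longrightarrow> \<not> b"
  shows "run b w (settle x c) m"
proof (cases E)
  case Nil
  then have "run b w c (m(0 := 9))"
    using assms(1,2) Z_le by (intro assms(3)) auto
  then show ?thesis
    using Nil assms(1,2) Z_le by (auto simp: settle_def)
next
  case (Cons eq E')
  obtain e q where eq: "eq = (e, q)" by fastforce
  have len: "12 + 3 * length E' \<le> V"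
    using assms(1)[unfolded bounded_def, rule_format, of 3] assms(2) Cons by simp
  have cells: "m (10 + 3 * length E') = e" "m (11 + 3 * length E') = q" "q \<le> K"
    using assms(2) Cons eq by simp_all
  have cell_le: "m j \<le> V" for j
  proof -
    have "cell_bound j \<le> V"
      using M_le K_le by (simp add: cell_bound_def)
    then show ?thesis
      using assms(1) le_trans unfolding bounded_def by blast
  qed
  have "e \<le> V" using cell_le cells by metis
  let ?m = "m(1 := 2, 0 := e)"
  have b: "bounded ?m"
    using assms(1) \<open>e \<le> V\<close> Z_le by simp
  have "run b w (if e < d then c else pop_entry x c) ?m"
  proof (cases "e < d")
    case True
    then show ?thesis
      using assms(2) Cons eq b by (auto intro!: assms(3))
  next
    case False
    let ?n = "m(0 := q, 1 := 3, 3 := 9 + 3 * length E')"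
    have b': "bounded ?n"
      using assms(1) len Z_le cells K_le by simp
    have "run b w (branch K (\<lambda>q. check (acc q x) c)) ?n"
    proof (rule run_branch[OF b'])
      fix v assume v: "v \<le> V"
      have bv: "bounded (?n(1 := v))"
        using b' by (rule bounded_upd) (use v in simp)
      moreover have "run b w c (?n(1 := v))" if "acc q x"
        using bv that assms(2) Cons False eq by (intro assms(4)) auto
      ultimately show "run b w (check (acc (?n 0) x) c) (?n(1 := v))"
        using assms(5) Cons False eq by (auto intro!: run_check)
    qed (use cells K_le in simp_all)
    then show ?thesis
      using False Cons assms(1,2) Z_le len b cells \<open>e \<le> V\<close> K_le
      by (auto simp: pop_entry_def decr_def fun_upd_twist simp del: One_nat_def)
  qed
  then show ?thesis
    using Cons assms(1,2) Z_le len b cells by (auto simp: settle_def simp del: One_nat_def split: if_splits)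
qed

lemma run_closed_opening:
  assumes "bounded m" "represents (d, B, E, R) m" "fits M (d, B, E, R)" "q \<le> K"
    "case advance (Closed q) (d, B, E, R) (Opening x) of
       None \<Rightarrow> \<not> b
     | Some (c', \<sigma>') \<Rightarrow> fits M \<sigma>' \<and> (\<forall>m'. bounded m' \<longrightarrow> represents \<sigma>' m' \<longrightarrow> run b w (Next c') m')"
  shows "run b w (pop_label q (enter x)) m"
proof (rule run_pop_label[OF assms(1,2)])
  have "R \<le> X"
    using assms(3) by (intro resets_le) (simp add: fits_def)
  show "d \<le> M"
    using assms(3) by (simp add: fits_def)
  \<comment> \<open>Room for the entry is read off the successor store, which fits with one more
    entry.\<close>
  show "length E < X" if "B = []"
    using assms(5) that \<open>R \<le> X\<close> by (simp add: fits_def)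
  show "\<not> b" if "B \<noteq> []" "\<not> acc q (hd B)"
    using assms(5) that by (cases B) auto
  show "run b w (enter x) m'" if "bounded m'" "B = []" "represents (d, [], (d, q) # E, R) m'" for m'
    using assms(5) that by (intro run_enter[of m' d "[]" "(d, q) # E" R]) (auto simp: fits_def)
  show "run b w (enter x) m'"
    if "bounded m'" "B \<noteq> []" "acc q (hd B)" "represents (d, tl B, E, R) m'" for m'
    using assms(5) that by (intro run_enter[of m' d "tl B" E R]) (auto simp: fits_def neq_Nil_conv)
qed (rule assms(4))

lemma run_opened_opening:
  assumes "bounded m" "represents (d, B, E, R) m" "fits M (d, B, E, R)"
    "case advance (Opened y) (d, B, E, R) (Opening x) of
       None \<Rightarrow> \<not> b
     | Some (c', \<sigma>') \<Rightarrow> fits M \<sigma>' \<and> (\<forall>m'. bounded m' \<longrightarrow> represents \<sigma>' m' \<longrightarrow> run b w (Next c') m')"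
  shows "run b w (push_label (code y) (enter x)) m"
proof (rule run_push_label[OF assms(1,2)])
  show "length B \<le> capacity R" "R \<le> X"
    using assms(3) resets_le[of R] by (simp_all add: fits_def)
  show "Suc R \<le> X" if "capacity R \<le> length B"
    using assms(4) that resets_le[of "Suc R"] by (simp add: fits_def)
  show "run b w (enter x) m'" if "bounded m'"
    "represents (if length B < capacity R then (d, y # B, E, R) else (d, [], E, Suc R)) m'" for m'
  proof (cases "length B < capacity R")
    case True
    then show ?thesis
      using assms(4) that by (intro run_enter[of m' d "y # B" E R]) (auto simp: fits_def)
  next
    case False
    then show ?thesis
      using assms(4) that by (intro run_enter[of m' d "[]" E "Suc R"]) (auto simp: fits_def)
  qed
qed

lemma run_closed_closing:
  assumes "bounded m" "represents (d, B, E, R) m"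
    "case advance (Closed q) (d, B, E, R) (Closing x) of
       None \<Rightarrow> \<not> b
     | Some (c', \<sigma>') \<Rightarrow> fits M \<sigma>' \<and> (\<forall>m'. bounded m' \<longrightarrow> represents \<sigma>' m' \<longrightarrow> run b w (Next c') m')"
  shows "run b w (settle x (exit q x)) m"
proof (rule run_settle[OF assms(1,2)])
  show "run b w (exit q x) m'"
    if "bounded m'" "represents (d, B, E, R) m'" "E = [] \<or> fst (hd E) < d" for m'
    using assms(3) that by (intro run_exit[of m' d B E R]) (auto split: list.splits)
  show "run b w (exit q x) m'"
    if "bounded m'" "E \<noteq> []" "\<not> fst (hd E) < d" "acc (snd (hd E)) x" "represents (d, B, tl E, R) m'" for m'
    using assms(3) that by (intro run_exit[of m' d B "tl E" R]) (auto simp: neq_Nil_conv)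
  show "\<not> b" if "E \<noteq> []" "\<not> fst (hd E) < d" "\<not> acc (snd (hd E)) x"
    using assms(3) that by (auto simp: neq_Nil_conv)
qed

lemma run_letter:
  assumes "bounded m" "represents \<sigma> m" "fits M \<sigma>" "\<And>q. c = Closed q \<Longrightarrow> q \<le> K"
    "case advance c \<sigma> a of
       None \<Rightarrow> \<not> b
     | Some (c', \<sigma>') \<Rightarrow> fits M \<sigma>' \<and> (\<forall>m'. bounded m' \<longrightarrow> represents \<sigma>' m' \<longrightarrow> run b w (Next c') m')"
  shows "run b w (handler c (Some a)) m"
proof -
  obtain d B E R where \<sigma>: "\<sigma> = (d, B, E, R)"
    by (cases \<sigma>)
  show ?thesis
  proof (cases a)
    case (Opening x)
    show ?thesis
    proof (cases c)
      case Start
      then show ?thesis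
        using assms \<sigma> Opening by (auto intro!: run_enter[of m d B E R] simp: fits_def)
    next
      case (Opened y)
      then show ?thesis
        using run_opened_opening[OF assms(1) assms(2,3,5)[unfolded \<sigma> Opened Opening]]
        by (simp add: Opening)
    next
      case (Closed q)
      then show ?thesis
        using run_closed_opening[OF assms(1) assms(2,3)[unfolded \<sigma>] assms(4)[OF Closed]
            assms(5)[unfolded \<sigma> Closed Opening]]
        by (simp add: Opening)
    qed
  next
    case (Closing x)
    show ?thesis
    proof (cases c)
      case Start
      then show ?thesis
        using assms \<sigma> Closing by simp
    next
      case (Opened y)
      then show ?thesis
        using assms \<sigma> Closing by (auto intro!: run_check run_exit[of m d B E R] split: if_splits)
    next
      case (Closed q)
      then show ?thesis
        using run_closed_closing[OF assms(1) assms(2,5)[unfolded \<sigma> Closed Closing]]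
        by (simp add: Closing)
    qed
  qed
qed

lemma advance_Closed_le: "advance c \<sigma> a = Some (Closed q, \<sigma>') \<Longrightarrow> q \<le> K"
  by (cases c; cases a; cases \<sigma>) (auto simp: \<delta>_le split: list.splits if_splits prod.splits)

lemma run_word:
  assumes "accepts (fits M) b c \<sigma> w" "bounded m" "represents \<sigma> m" "\<And>q. c = Closed q \<Longrightarrow> q \<le> K"
  shows "run b w (Next c) m"
  using assms
proof (induction w arbitrary: c \<sigma> m)
  case Nil
  then show ?case
    by (intro runs.End) simp_all
next
  case (Cons a w)
  have "fits M \<sigma>' \<and> (\<forall>m'. bounded m' \<longrightarrow> represents \<sigma>' m' \<longrightarrow> run b w (Next c') m')"
    if "advance c \<sigma> a = Some (c', \<sigma>')" for c' \<sigma>'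
  proof -
    have acc: "accepts (fits M) b c' \<sigma>' w"
      using Cons.prems(1) that by simp
    then have "fits M \<sigma>'"
      by (cases w) simp_all
    moreover have "q \<le> K" if "c' = Closed q" for q
      using advance_Closed_le \<open>advance c \<sigma> a = Some (c', \<sigma>')\<close> that by blast
    ultimately show ?thesis
      using Cons.IH[OF acc] by blast
  qed
  then have "run b w (handler c (Some a)) m"
    using Cons.prems by (intro run_letter[of m \<sigma>]) (auto split: option.split)
  then show ?case
    using Cons.prems(2) by (intro runs.Read)
qed

theorem run_start:
  assumes "accepts (fits M) b Start (0, [], [], 0) w"
  shows "run b w start (\<lambda>_. 0)"
proof -
  have "bounded (\<lambda>_. 0)"
    by (simp add: bounded_def)
  moreover have "floorlog 2 0 = 0" "capacity 0 = 0"
    by (simp_all add: floorlog_def capacity_def)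
  ultimately show ?thesis
    using Z_le assms by (auto simp: start_def intro!: run_word)
qed

end

section \<open>Resource bounds\<close>

definition max_resets :: "nat \<Rightarrow> nat" where
  "max_resets M = Max {R. pushes R \<le> M}"

lemma less_two_power_floorlog: "n < 2 ^ floorlog 2 n"
  using floorlog_bounds[of n 2] by (cases "n = 0") simp_all

lemma two_power_floorlog_le: "2 ^ floorlog 2 n \<le> 2 * n + 1"
proof (cases "n = 0")
  case False
  then have "2 ^ (floorlog 2 n - 1) \<le> n" "floorlog 2 n \<noteq> 0"
    using floorlog_bounds[of n 2] by (auto simp: floorlog_eq_zero_iff)
  then show ?thesis
    by (cases "floorlog 2 n") simp_all
qed (simp add: floorlog_def)

lemma capacity_ge: "R \<le> capacity R"
  using less_two_power_floorlog[of R] by (cases "floorlog 2 R") (auto simp: capacity_def)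

lemma capacity_mono: "R \<le> R' \<Longrightarrow> capacity R \<le> capacity R'"
  by (auto simp: capacity_def intro!: mult_mono floorlog_mono)

lemma square_le_pushes: "R * R \<le> 2 * pushes R + R"
proof (induction R)
  case (Suc R)
  then show ?case
    using capacity_ge[of R] by simp
qed simp

text \<open>The first clearing is free, as \<open>capacity 0\<close> is 0; later ones cost a push
  each. This makes the set under \<open>Max\<close> in \<open>max_resets\<close> finite.\<close>

lemma le_Suc_pushes: "R \<le> Suc (pushes R)"
proof (cases R)
  case (Suc k)
  have "k \<le> pushes (Suc k)"
    by (cases k) (use capacity_ge[of k] in simp_all)
  with Suc show ?thesis by simp
qed simp

lemma pushes_max_resets: "pushes (max_resets M) \<le> M"
  and resets_le_max: "pushes R \<le> M \<Longrightarrow> R \<le> max_resets M"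
proof -
  have "R \<le> Suc M" if "pushes R \<le> M" for R
    using le_Suc_pushes[of R] that by linarith
  then have "{R. pushes R \<le> M} \<subseteq> {..Suc M}"
    by blast
  then have fin: "finite {R. pushes R \<le> M}"
    by (rule finite_subset) simp
  moreover have "0 \<in> {R. pushes R \<le> M}"
    by simp
  ultimately show "pushes (max_resets M) \<le> M"
    unfolding max_resets_def using Max_in by blast
  show "pushes R \<le> M \<Longrightarrow> R \<le> max_resets M"
    unfolding max_resets_def using fin by (intro Max_ge) auto
qed

lemma max_resets_le: "max_resets M \<le> Suc M"
  using le_Suc_pushes[of "max_resets M"] pushes_max_resets[of M] by linarith

text \<open>Keeps the upper half of the summands of \<open>pushes\<close>, each at least the
  capacity at the midpoint.\<close>

lemma half_capacity_le: "(max_resets M div 2) * capacity (max_resets M div 2) \<le> M"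
proof -
  define X h where "X = max_resets M" and "h = X div 2"
  have "h * capacity h \<le> (X - h) * capacity h"
    by (intro mult_right_mono) (auto simp: h_def)
  also have "\<dots> = (\<Sum>i=h..<X. capacity h)"
    by simp
  also have "\<dots> \<le> (\<Sum>i=h..<X. capacity i)"
    by (intro sum_mono capacity_mono) simp
  also have "\<dots> \<le> pushes X"
    unfolding pushes_def by (intro sum_mono2) auto
  finally show ?thesis
    using pushes_max_resets[of M] by (simp add: X_def h_def)
qed

definition max_cells :: "nat \<Rightarrow> nat" where
  "max_cells M = capacity (max_resets M) + max_resets M"

definition max_value :: "nat \<Rightarrow> nat \<Rightarrow> nat" where
  "max_value K M = 12 + 3 * max_cells M + M + K + 2 * max_resets M + 1"

definition space :: "nat \<Rightarrow> nat \<Rightarrow> nat" where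
  "space K M = 9 * Suc (floorlog 2 (max_value K M)) + max_resets M * Suc (floorlog 2 M) +
     3 * max_cells M * Suc (floorlog 2 K)"

text \<open>A crude linear bound suffices here: it controls addresses, hence the size of integers,
  not the space.\<close>

lemma max_cells_le: "max_cells M \<le> 4 * M + 2"
proof -
  let ?X = "max_resets M"
  have "floorlog 2 ?X \<le> ?X"
    using less_exp[of ?X] by (intro floorlog_leI) simp_all
  then have "capacity ?X \<le> ?X * ?X"
    by (simp add: capacity_def)
  then show ?thesis
    using square_le_pushes[of ?X] pushes_max_resets[of M] max_resets_le[of M]
    by (simp add: max_cells_def)
qed

lemma max_value_le: "max_value K M \<le> 15 * M + 21 + K"
  using max_cells_le[of M] max_resets_le[of M] by (simp add: max_value_def)

lemma floorlog_le_log: "1 \<le> n \<Longrightarrow> real (floorlog 2 n) \<le> 1 + log 2 (real n)"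
  by (simp add: floorlog_def)

lemma log_less_floorlog: "log 2 (real n + 1) \<le> real (floorlog 2 n)"
proof -
  have "real (Suc n) \<le> real (2 ^ floorlog 2 n)"
    using less_two_power_floorlog[of n] by (intro of_nat_mono) simp
  then have "log 2 (real (Suc n)) \<le> log 2 (2 ^ floorlog 2 n)"
    by (intro log_mono) simp_all
  then show ?thesis
    by (simp add: add.commute)
qed

lemma log2_le_sqrt:
  assumes "1 \<le> x"
  shows "log 2 x \<le> 4 * sqrt x"
proof -
  have "ln x = 2 * ln (sqrt x)"
    using assms by (simp add: ln_sqrt)
  also have "\<dots> \<le> 2 * sqrt x"
    using ln_le_minus_one[of "sqrt x"] assms by simp
  finally have "ln x \<le> 2 * sqrt x" .
  moreover have "1 / 2 \<le> ln (2 :: real)"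
    using ln_le_minus_one[of "1 / 2"] by (simp add: ln_div)
  then have "4 * sqrt x * (1 / 2) \<le> 4 * sqrt x * ln 2"
    using assms by (intro mult_left_mono) simp_all
  ultimately have "ln x \<le> 4 * sqrt x * ln 2"
    by linarith
  then show ?thesis
    by (simp add: log_def field_simps)
qed

text \<open>Amounts to \<open>max_resets M\<close> being O(sqrt(M / log M)). With \<open>h\<close>
  half of it, counting pushes bounds the square of \<open>h\<close> times the logarithm of
  \<open>h + 1\<close>, not of \<open>M\<close>. If \<open>M\<close> is at most the fourth power of
  \<open>h + 1\<close>, the logarithms differ by a factor of at most 4; otherwise both the square of
  \<open>h\<close> and \<open>log 2 M\<close> are O(sqrt M). The constant has slack: 8 * 4 + 8 =
  40.\<close>

lemma resets_log_bound:
  assumes "2 \<le> M"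
  shows "(real (max_resets M) + 1)\<^sup>2 * log 2 (real M) \<le> 160 * real M"
proof -
  define h where "h = max_resets M div 2"
  have log1: "1 \<le> log 2 (real M)"
    using assms by (simp add: le_log_iff)
  have logM: "log 2 (real M) \<le> real M"
    using assms by (intro log2_of_power_le less_imp_le of_nat_less_two_power less_exp) simp
  have "real h * real (capacity h) \<le> real M"
    using half_capacity_le[of M] unfolding h_def by (metis of_nat_mono of_nat_mult)
  then have "(real h)\<^sup>2 * real (floorlog 2 h) \<le> real M"
    by (simp add: capacity_def power2_eq_square mult.assoc)
  moreover have "(real h)\<^sup>2 * log 2 (real h + 1) \<le> (real h)\<^sup>2 * real (floorlog 2 h)"
    by (intro mult_left_mono log_less_floorlog) simp
  ultimately have h: "(real h)\<^sup>2 * log 2 (real h + 1) \<le> real M"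
    by linarith
  have hlog: "(real h)\<^sup>2 * log 2 (real M) \<le> 4 * real M"
  proof (cases "real M \<le> (real h + 1) ^ 4")
    case True
    then have "log 2 (real M) \<le> log 2 ((real h + 1) ^ 4)"
      using assms by (intro log_mono) simp_all
    then have "log 2 (real M) \<le> 4 * log 2 (real h + 1)"
      by (simp add: log_nat_power)
    then have "(real h)\<^sup>2 * log 2 (real M) \<le> (real h)\<^sup>2 * (4 * log 2 (real h + 1))"
      by (intro mult_left_mono) simp_all
    with h show ?thesis by simp
  next
    case False
    have "((real h)\<^sup>2)\<^sup>2 \<le> (real h + 1) ^ 4"
      unfolding power_mult[symmetric] by (simp add: power_mono)
    with False have "((real h)\<^sup>2)\<^sup>2 \<le> real M"
      by linarith
    then have "(real h)\<^sup>2 \<le> sqrt (real M)"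
      by (simp add: real_le_rsqrt)
    then have "(real h)\<^sup>2 * log 2 (real M) \<le> sqrt (real M) * (4 * sqrt (real M))"
      using log1 log2_le_sqrt[of "real M"] assms by (intro mult_mono) simp_all
    also have "\<dots> = 4 * (sqrt (real M) * sqrt (real M))"
      by (simp only: mult_ac)
    finally show ?thesis by simp
  qed
  have "real (max_resets M) + 1 \<le> 2 * real h + 2"
    unfolding h_def by linarith
  then have "(real (max_resets M) + 1)\<^sup>2 \<le> (2 * real h + 2)\<^sup>2"
    by (intro power_mono) simp_all
  also have "\<dots> \<le> 8 * (real h)\<^sup>2 + 8"
    using sum_squares_bound[of "real h" 1] by (simp add: power2_sum power_mult_distrib)
  finally have "(real (max_resets M) + 1)\<^sup>2 * log 2 (real M) \<le> (8 * (real h)\<^sup>2 + 8) * log 2 (real M)"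
    using log1 by (intro mult_right_mono) simp_all
  also have "\<dots> \<le> 160 * real M"
    using hlog logM by (simp add: algebra_simps)
  finally show ?thesis .
qed

text \<open>Nine fixed cells give the first summand. In 15 = 3 + 3 * 4, the 3 pays for the depths
  and 3 * 4 for three cells in each stack slot.\<close>

lemma space_le_log:
  assumes "2 \<le> M"
  shows "real (space K M) \<le>
    (9 * (log 2 (real K + 50) + 3) + 15 * (real (floorlog 2 K) + 1)) *
      ((real (max_resets M) + 1) * log 2 (real M))"
proof -
  define X l k where "X = real (max_resets M)" and "l = log 2 (real M)" and "k = real (floorlog 2 K) + 1"
  have l: "1 \<le> l"
    using assms by (simp add: le_log_iff l_def)
  have X: "0 \<le> X" and k: "1 \<le> k"
    by (simp_all add: X_def k_def)
  have c: "0 \<le> log 2 (real K + 50)"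
    by (simp add: zero_le_log_cancel_iff)
  have flM: "real (floorlog 2 M) \<le> 1 + l"
    using floorlog_le_log[of M] assms by (simp add: l_def)
  have "floorlog 2 (max_resets M) \<le> floorlog 2 (Suc M)"
    by (intro floorlog_mono max_resets_le)
  also have "\<dots> \<le> Suc (floorlog 2 M)"
    by (simp add: floorlog_Suc)
  finally have flX: "real (floorlog 2 (max_resets M)) \<le> 2 + l"
    using flM by simp
  have "K \<le> K * M"
    using assms by (cases M) simp_all
  then have "max_value K M \<le> (K + 50) * M"
    using max_value_le[of K M] assms unfolding add_mult_distrib by linarith
  then have "real (max_value K M) \<le> real ((K + 50) * M)"
    by (rule of_nat_mono)
  moreover have "1 \<le> max_value K M"
    by (simp add: max_value_def)
  ultimately have "log 2 (real (max_value K M)) \<le> log 2 ((real K + 50) * real M)"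
    by (intro log_mono) simp_all
  also have "\<dots> = log 2 (real K + 50) + l"
    using assms by (simp add: l_def log_mult)
  finally have flV: "real (floorlog 2 (max_value K M)) \<le> 1 + log 2 (real K + 50) + l"
    using floorlog_le_log[of "max_value K M"] \<open>1 \<le> max_value K M\<close> by simp
  have t1: "real (floorlog 2 (max_value K M)) + 1 \<le> (log 2 (real K + 50) + 3) * ((X + 1) * l)"
  proof -
    have "real (floorlog 2 (max_value K M)) + 1 \<le> 2 + log 2 (real K + 50) + l"
      using flV by simp
    also have "\<dots> \<le> (log 2 (real K + 50) + 3) * l"
      using l mult_left_mono[OF l c] unfolding distrib_right mult_1_right by linarith
    also have "\<dots> \<le> (log 2 (real K + 50) + 3) * ((X + 1) * l)"
      using l X c by (intro mult_left_mono) (simp_all add: algebra_simps)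
    finally show ?thesis .
  qed
  have t2: "X * (real (floorlog 2 M) + 1) \<le> 3 * ((X + 1) * l)"
  proof -
    have "X * (real (floorlog 2 M) + 1) \<le> X * (3 * l)"
      using flM l X by (intro mult_left_mono) simp_all
    also have "\<dots> \<le> 3 * ((X + 1) * l)"
      using l by (simp add: algebra_simps)
    finally show ?thesis .
  qed
  have t3: "real (max_cells M) \<le> 4 * ((X + 1) * l)"
  proof -
    have "real (max_cells M) = X * (real (floorlog 2 (max_resets M)) + 1)"
      by (simp add: max_cells_def capacity_def X_def algebra_simps)
    also have "\<dots> \<le> X * (4 * l)"
      using flX l X by (intro mult_left_mono) simp_all
    also have "\<dots> \<le> 4 * ((X + 1) * l)"
      using l by (simp add: algebra_simps)
    finally show ?thesis .
  qed
  define P where "P = (X + 1) * l"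
  have P: "0 \<le> P"
    using X l by (simp add: P_def)
  have "3 * P * 1 \<le> 3 * P * k"
    using k P by (intro mult_left_mono) simp_all
  moreover have "real (max_cells M) * k \<le> 4 * P * k"
    using k t3 by (intro mult_right_mono) (simp_all add: P_def)
  moreover have "real (space K M) = 9 * (real (floorlog 2 (max_value K M)) + 1) +
      X * (real (floorlog 2 M) + 1) + 3 * (real (max_cells M) * k)"
    unfolding space_def X_def k_def by (simp add: distrib_left)
  moreover have "9 * u + v + 3 * w \<le> (9 * c + 15 * k) * P"
    if "u \<le> c * P" "v \<le> 3 * P" "3 * P * 1 \<le> 3 * P * k" "w \<le> 4 * P * k" for u v w c
    using that unfolding distrib_right mult.assoc mult.commute[of k P] mult_1_right by linarith
  ultimately show ?thesis
    using t1 t2 unfolding P_def X_def l_def k_def by metis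
qed

lemma space_bigo: "(\<lambda>N. real (space K (2 * N + 1))) \<in> O(\<lambda>N. sqrt (real N * log 2 (real N)))"
proof (rule bigoI)
  define C where "C = 9 * (log 2 (real K + 50) + 3) + 15 * (real (floorlog 2 K) + 1)"
  have C: "0 \<le> C"
    using zero_le_log_cancel_iff[of 2 "real K + 50"] by (simp add: C_def)
  show "\<forall>\<^sub>F N in sequentially. norm (real (space K (2 * N + 1))) \<le>
      C * sqrt 1440 * norm (sqrt (real N * log 2 (real N)))"
    using eventually_ge_at_top[of 2]
  proof eventually_elim
    case (elim N)
    define M where "M = 2 * N + 1"
    define l where "l = log 2 (real M)"
    \<comment> \<open>The cubic bound yields \<open>log 2 M \<le> 3 * log 2 N\<close>; with
      \<open>M \<le> 3 * N\<close> this explains 1440 = 160 * 3 * 3.\<close>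
    have M: "2 \<le> M" "real M \<le> 3 * real N" "real M \<le> real N ^ 3"
    proof -
      have "2 * 2 \<le> real N * real N"
        using elim by (intro mult_mono) simp_all
      then have "3 * real N \<le> (real N * real N) * real N"
        by (intro mult_right_mono) simp_all
      moreover show "real M \<le> 3 * real N" "2 \<le> M"
        using elim by (simp_all add: M_def)
      ultimately show "real M \<le> real N ^ 3"
        unfolding power3_eq_cube by linarith
    qed
    have l: "0 \<le> l" "l \<le> 3 * log 2 (real N)"
    proof -
      show "0 \<le> l"
        using M(1) by (simp add: l_def)
      have "l \<le> log 2 (real N ^ 3)"
        unfolding l_def using M by (intro log_mono) simp_all
      then show "l \<le> 3 * log 2 (real N)"
        using elim by (simp add: log_nat_power)
    qed
    have "((real (max_resets M) + 1) * l)\<^sup>2 = ((real (max_resets M) + 1)\<^sup>2 * l) * l"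
      by (simp add: power2_eq_square)
    also have "\<dots> \<le> (160 * real M) * l"
      using resets_log_bound[OF M(1)] l by (intro mult_right_mono) (simp_all add: l_def)
    also have "\<dots> \<le> (160 * (3 * real N)) * (3 * log 2 (real N))"
      using M l by (intro mult_mono) simp_all
    also have "\<dots> = 1440 * (real N * log 2 (real N))"
      by simp
    finally have "(real (max_resets M) + 1) * l \<le> sqrt (1440 * (real N * log 2 (real N)))"
      by (rule real_le_rsqrt)
    then have "C * ((real (max_resets M) + 1) * l) \<le> C * sqrt (1440 * (real N * log 2 (real N)))"
      using C by (intro mult_left_mono)
    then have "real (space K M) \<le> C * (sqrt 1440 * sqrt (real N * log 2 (real N)))"
      using space_le_log[OF M(1), of K] by (simp add: C_def l_def real_sqrt_mult)
    moreover have "0 \<le> log 2 (real N)"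
      using elim by simp
    ultimately show ?case
      by (simp add: M_def mult.assoc)
  qed
qed

section \<open>The streaming algorithm\<close>

instance tag :: (finite) finite
proof
  have "(UNIV :: 'a tag set) = range Opening \<union> range Closing"
    by (auto simp: image_iff) (metis tag.exhaust)
  then show "finite (UNIV :: 'a tag set)"
    by (rule ssubst) simp
qed

context coding
begin

lemma bounded_codingI: "bounded_coding \<delta> q0 code decode K M (max_value K M) (max_resets M) (max_cells M)"
proof unfold_locales
  show "R \<le> max_resets M" if "pushes R \<le> M" for R
    using that by (rule resets_le_max)
  show "capacity R \<le> max_cells M" if "R \<le> max_resets M" for R
    using capacity_mono[OF that] by (simp add: max_cells_def)
  show "2 ^ floorlog 2 R \<le> max_value K M" if "R \<le> max_resets M" for R
    using two_power_floorlog_le[of R] that by (simp add: max_value_def)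
qed (simp_all add: max_value_def max_cells_def)

lemma Next_branch: "Next s \<in> subcodes (branch n f) \<Longrightarrow> \<exists>i. Next s \<in> subcodes (f i)"
  by (induction n) auto

text \<open>The type \<open>control\<close> is infinite, but only states up to \<open>K\<close> are
  ever entered, as the compilation requires.\<close>

lemma Next_handler:
  assumes "Next s \<in> subcodes (handler c a)"
  shows "s \<in> {Start} \<union> range Opened \<union> Closed ` {..K}"
proof -
  have "(\<exists>x. s = Opened x) \<or> (\<exists>x q. s = Closed (\<delta> x q))"
    using assms
    by (cases "(c, a)" rule: handler.cases)
      (auto simp: push_label_def clear_labels_def set_limit_def push_entry_def pop_label_def
        settle_def pop_entry_def enter_def exit_def incr_def decr_def check_def
        dest!: Next_branch split: if_splits)
  then show ?thesis
    using \<delta>_le by auto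
qed

end

context bounded_coding
begin

text \<open>\<open>Suc\<close> keeps the width positive even where the bound is 0.\<close>

definition width :: "nat \<Rightarrow> nat" where
  "width j = Suc (floorlog 2 (cell_bound j))"

lemma sum_width:
  "n \<le> Z \<Longrightarrow> (\<Sum>j<9 + 3 * n. width j) \<le>
     9 * Suc (floorlog 2 V) + min n X * Suc (floorlog 2 M) + 3 * n * Suc (floorlog 2 K)"
proof (induction n)
  case 0
  have "(\<Sum>j<9. width j) = (\<Sum>j<9::nat. Suc (floorlog 2 V))"
    by (intro sum.cong) (simp_all add: width_def)
  then show ?case by simp
next
  case (Suc n)
  define v m k where "v = Suc (floorlog 2 V)" and "m = Suc (floorlog 2 M)" and "k = Suc (floorlog 2 K)"
  have "width (9 + 3 * n) = k" "width (11 + 3 * n) = k"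
    using Suc.prems by (simp_all add: width_def k_def)
  moreover have "width (10 + 3 * n) \<le> (if n < X then m else k)"
  proof (cases "n < X")
    case False
    then have "cell_bound (10 + 3 * n) \<le> K"
      by (simp add: cell_bound_def)
    with False show ?thesis
      by (simp add: width_def k_def floorlog_mono)
  qed (simp add: width_def m_def)
  moreover have "(\<Sum>j<9 + 3 * Suc n. width j) =
      (\<Sum>j<9 + 3 * n. width j) + width (9 + 3 * n) + width (10 + 3 * n) + width (11 + 3 * n)"
    by (simp add: eval_nat_numeral)
  moreover have "min (Suc n) X * m = min n X * m + (if n < X then m else 0)"
    by (simp add: min_def)
  moreover have "3 * Suc n * k = 3 * n * k + 3 * k"
    by (simp add: add_mult_distrib)
  moreover have "(\<Sum>j<9 + 3 * n. width j) \<le> 9 * v + min n X * m + 3 * n * k"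
    using Suc unfolding v_def m_def k_def by simp
  ultimately show ?case
    unfolding v_def[symmetric] m_def[symmetric] k_def[symmetric] by (auto split: if_splits)
qed

lemma space_le_if_bounded:
  assumes "\<And>n. bounded (mem (config_at P w n))"
  shows "space_le P w (9 * Suc (floorlog 2 V) + X * Suc (floorlog 2 M) + 3 * Z * Suc (floorlog 2 K))"
  unfolding space_le_def
proof (intro exI[of _ "map width [0..<9 + 3 * Z]"] conjI allI)
  have "sum_list (map width [0..<9 + 3 * Z]) = (\<Sum>j<9 + 3 * Z. width j)"
    by (simp only: interv_sum_list_conv_sum_set_nat set_upt atLeast0LessThan)
  then show "sum_list (map width [0..<9 + 3 * Z]) \<le>
      9 * Suc (floorlog 2 V) + X * Suc (floorlog 2 M) + 3 * Z * Suc (floorlog 2 K)"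
    using sum_width[of Z] X_le by simp
  show "\<forall>k\<in>set (map width [0..<9 + 3 * Z]). 0 < k"
    by (auto simp: width_def)
  fix n i
  let ?m = "mem (config_at P w n)"
  have le: "?m i \<le> cell_bound i"
    using assms[of n] by (simp add: bounded_def)
  have "?m i < 2 ^ width i"
    using le less_two_power_floorlog[of "cell_bound i"] unfolding width_def power_Suc by linarith
  moreover have "?m i = 0" if "\<not> i < 9 + 3 * Z"
    using le that by (simp add: cell_bound_def)
  ultimately show "if i < length (map width [0..<9 + 3 * Z])
      then ?m i < 2 ^ (map width [0..<9 + 3 * Z] ! i) else ?m i = 0"
    by (auto simp del: upt_Suc)
qed

lemma integers_le_if_bounded:
  assumes "\<And>n. bounded (mem (config_at P w n))"
  shows "integers_le P w V"
  unfolding integers_le_def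
proof (intro allI)
  fix n i
  have "mem (config_at P w n) i \<le> cell_bound i"
    using assms by (simp add: bounded_def)
  also have "\<dots> \<le> V"
    using M_le K_le by (simp add: cell_bound_def)
  finally show "mem (config_at P w n) i \<le> V" .
qed

end

theorem theorem4:
  fixes D :: "'a::finite dtd"
  shows "\<exists>(P :: 'a option tag program) (S :: nat \<Rightarrow> nat) (T :: nat \<Rightarrow> nat) (B :: nat \<Rightarrow> nat).
     (\<lambda>N. real (S N)) \<in> O(\<lambda>N. sqrt (real N * log 2 (real N))) \<and>
     (\<lambda>N. real (T N)) \<in> O(\<lambda>N. 1) \<and>
     (\<lambda>N. real (B N)) \<in> O(\<lambda>N. real N) \<and>
     (\<forall>t :: 'a utree.
        answers P (XML (FCNS_bot t)) (valid D t) \<and>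
        space_le P (XML (FCNS_bot t)) (S (num_nodes t)) \<and>
        time_per_letter_le P (XML (FCNS_bot t)) (T (num_nodes t)) \<and>
        integers_le P (XML (FCNS_bot t)) (B (num_nodes t)))"
proof -
  obtain K0 q0 and \<delta> :: "'a \<Rightarrow> nat \<Rightarrow> nat" and acc :: "nat \<Rightarrow> 'a \<Rightarrow> bool"
    where q0: "q0 \<le> K0" and \<delta>: "\<And>a q. \<delta> a q \<le> K0"
      and acc: "\<And>w a. acc (foldr \<delta> w q0) a \<longleftrightarrow> w \<in> lang (D a)"
    by (rule dtd_automaton[of D]) (rule that)
  obtain code :: "'a option \<Rightarrow> nat" and k where code: "range code = {i. i < k}" "inj code"
    using finite_imp_inj_to_nat_seg[of "UNIV :: 'a option set"] by auto
  define K where "K = max K0 k"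
  interpret dtd_states D \<delta> acc q0
    by unfold_locales (rule acc)
  let ?\<delta> = "on_option (\<lambda>_. q0) \<delta>" and ?acc = "\<lambda>q. on_option True (acc q)"
  interpret c: coding ?\<delta> ?acc q0 code "inv code" K
  proof unfold_locales
    have "code x < k" for x
      using code(1) by blast
    then show "code x \<le> K" for x
      by (simp add: K_def less_imp_le max.coboundedI2)
    show "inv code (code x) = x" for x
      using code(2) by simp
    show "q0 \<le> K"
      using q0 by (simp add: K_def)
    show "?\<delta> x q \<le> K" for x q
      using q0 \<delta>[of _ q] by (cases x) (simp_all add: K_def max.coboundedI1)
  qed
  obtain P and T :: nat where P:
    "\<And>w. time_per_letter_le P w T"
    "\<And>I b w. runs I c.handler b w c.start (\<lambda>_. 0) \<Longrightarrow> answers P w b"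
    "\<And>I b w n. runs I c.handler b w c.start (\<lambda>_. 0) \<Longrightarrow> I (mem (config_at P w n))"
  proof (rule code_compiles[of "{Start} \<union> range Opened \<union> Closed ` {..K}" c.start c.handler])
    show "s' \<in> {Start} \<union> range Opened \<union> Closed ` {..K}" if "Next s' \<in> subcodes (c.handler s l)" for s l s'
      using that by (rule c.Next_handler)
  qed (auto simp: c.start_def)
  show ?thesis
  proof (intro exI conjI allI)
    show "(\<lambda>N. real (space K (2 * N + 1))) \<in> O(\<lambda>N. sqrt (real N * log 2 (real N)))"
      by (rule space_bigo)
    show "(\<lambda>N. real T) \<in> O(\<lambda>N. 1)"
      by simp
    show "(\<lambda>N. real (max_value K (2 * N + 1))) \<in> O(\<lambda>N. real N)"
    proof (rule bigoI)
      show "\<forall>\<^sub>F N in sequentially. norm (real (max_value K (2 * N + 1))) \<le> (66 + real K) * norm (real N)"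
        using eventually_ge_at_top[of 1]
      proof eventually_elim
        case (elim N)
        have "max_value K (2 * N + 1) \<le> 30 * N + 36 + K"
          using max_value_le[of K "2 * N + 1"] by simp
        also have "\<dots> \<le> (66 + K) * N"
          using elim by (cases N) simp_all
        finally have "max_value K (2 * N + 1) \<le> (66 + K) * N" .
        then have "real (max_value K (2 * N + 1)) \<le> real ((66 + K) * N)"
          by (rule of_nat_mono)
        then show ?case by simp
      qed
    qed
    fix t :: "'a utree"
    let ?M = "2 * num_nodes t + 1" and ?w = "XML (FCNS_bot t)"
    \<comment> \<open>The size of \<open>t\<close> enters only now, after \<open>P\<close> has been
      fixed.\<close>
    interpret b: bounded_coding ?\<delta> ?acc q0 code "inv code" K ?M "max_value K ?M" "max_resets ?M" "max_cells ?M"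
      by (rule c.bounded_codingI)
    have run: "b.run (valid D t) ?w c.start (\<lambda>_. 0)"
      using accepts_XML[OF FCNS_bot_simps, of t, unfolded accepted_FCNS_bot] by (rule b.run_start)
    then show "answers P ?w (valid D t)"
      by (rule P(2))
    have bounded: "b.bounded (mem (config_at P ?w n))" for n
      using run by (rule P(3))
    show "space_le P ?w (space K ?M)"
      using b.space_le_if_bounded[OF bounded] by (simp only: space_def)
    show "time_per_letter_le P ?w T"
      by (rule P(1))
    show "integers_le P ?w (max_value K ?M)"
      using bounded by (rule b.integers_le_if_bounded)
  qed
qed

end
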